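(* Let $d\ge 2$, let $n_1,\dots,n_d$ be positive integers and let $k_i\ge 0$, $s_i\ge 0$ ($i=1,\dots,d-1$) be integers. Let $A\in\mathcal{M}_{=(k_{1},\dots,k_{d-1})}^{n_{1}\times\dots\times n_{d}}$, and for each $i=1,\dots,d-1$ let $A^{(n_1\dots n_i)\times(n_{i+1}\dots n_d)}=B_iC_i$ with $B_i\in\mathbb{R}^{(n_1\cdots n_i)\times k_i}$ and $C_i\in\mathbb{R}^{k_i\times(n_{i+1}\cdots n_d)}$. Then the tangent cone of the TT variety at $A$ is $$T_A\mathcal{M}_{\leq(k_{1}+s_{1},\dots,k_{d-1}+s_{d-1})}^{n_{1}\times\dots\times n_{d}}=\left\{\mathcal{X}\in\mathbb{R}^{n_1\times\dots\times n_d}:\ \operatorname{rank}\left((I-B_iB_i^{\dagger})\,\mathcal{X}^{(n_1\dots n_i)\times(n_{i+1}\dots n_d)}\,(I-C_i^{\dagger}C_i)\right)\leq s_i\ \text{ for all } i=1,\dots,d-1\right\}.$$ In particular it is the set of solutions of the system of polynomial equations expressing that all $(s_i+1)\times(s_i+1)$ minors of these matrices vanish, for all $i=1,\dots,d-1$.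
   Context: $A^{(n_1\dots n_i)\times(n_{i+1}\dots n_d)}$ denotes the matricization of $A\in\mathbb{R}^{n_1\times\dots\times n_d}$ obtained by grouping the first $i$ indices as row index and the remaining ones as column index (lexicographic order). $M^\dagger$ is the Moore-Penrose pseudoinverse. TT variety and TT manifold: $\mathcal{M}_{\leq(r_{1},\dots,r_{d-1})}^{n_{1}\times\dots\times n_{d}}=\{A\in\mathbb{R}^{n_{1}\times\dots\times n_{d}}:\forall i:\operatorname{rank}(A^{(n_{1}\dots n_{i})\times(n_{i+1}\dots n_{d})})\leq r_{i}\}$, and $\mathcal{M}_{=(r_{1},\dots,r_{d-1})}^{n_{1}\times\dots\times n_{d}}$ is defined by the same condition with $=$ in place of $\le$. Tangent cone (Bouligand contingent cone) of $\mathcal{M}\subset\mathbb{R}^N$ at $A\in\mathcal{M}$: $T_{A}\mathcal{M}=\{\xi\in\mathbb{R}^{N}:\exists(x_{n})\subset\mathcal{M},(a_{n})\subset\mathbb{R}^{+}\text{ s.t. }x_{n}\rightarrow A,\ a_{n}(x_{n}-A)\rightarrow\xi\}$. *)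

theory Defs
  imports
    "HOL-Analysis.Function_Topology"
    "Jordan_Normal_Form.DL_Rank_Submatrix"
begin

text \<open>A tensor of format \<open>ns = [n\<^sub>1, \<dots>, n\<^sub>d]\<close> is a function on multi-indices, which are lists of
  length \<open>d\<close> with zero-based entries \<open>j\<^sub>i < n\<^sub>i\<close>; it is zero off the admissible multi-indices, so
  that tensors of a format correspond one-to-one to points of \<open>\<real>\<^bsup>N\<^esup>\<close> with \<open>N = n\<^sub>1 \<cdots> n\<^sub>d\<close>.\<close>

type_synonym tensor = "nat list \<Rightarrow> real"

text \<open>\<^const>\<open>product_lists\<close> enumerates in lexicographic order, the first index varying slowest.\<close>

definition multi_indices :: "nat list \<Rightarrow> nat list list" where
  "multi_indices ns = product_lists (map (\<lambda>m. [0..<m]) ns)"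

definition tensors :: "nat list \<Rightarrow> tensor set" where
  "tensors ns = {A. \<forall>js. js \<notin> set (multi_indices ns) \<longrightarrow> A js = 0}"

definition matricization :: "nat list \<Rightarrow> nat \<Rightarrow> tensor \<Rightarrow> real mat" where
  "matricization ns i A = mat (prod_list (take i ns)) (prod_list (drop i ns))
     (\<lambda>(r, c). A (multi_indices (take i ns) ! r @ multi_indices (drop i ns) ! c))"

definition mat_rank :: "real mat \<Rightarrow> nat" where
  "mat_rank M = vec_space.rank (dim_row M) M"

definition TT_variety :: "nat list \<Rightarrow> (nat \<Rightarrow> nat) \<Rightarrow> tensor set" where
  "TT_variety ns r =
     {A \<in> tensors ns. \<forall>i\<in>{1..<length ns}. mat_rank (matricization ns i A) \<le> r i}"

definition TT_manifold :: "nat list \<Rightarrow> (nat \<Rightarrow> nat) \<Rightarrow> tensor set" where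
  "TT_manifold ns r =
     {A \<in> tensors ns. \<forall>i\<in>{1..<length ns}. mat_rank (matricization ns i A) = r i}"

text \<open>Limits are taken in the product topology of the function space, that is, entrywise; on
  \<^term>\<open>tensors ns\<close> this is the Euclidean topology.\<close>

definition tangent_cone :: "nat list \<Rightarrow> tensor set \<Rightarrow> tensor \<Rightarrow> tensor set" where
  "tangent_cone ns M A = {\<xi> \<in> tensors ns. \<exists>(x :: nat \<Rightarrow> tensor) (a :: nat \<Rightarrow> real).
     (\<forall>m. x m \<in> M) \<and> (\<forall>m. a m > 0) \<and> x \<longlonglongrightarrow> A \<and>
     (\<lambda>m js. a m * (x m js - A js)) \<longlonglongrightarrow> \<xi>}"

lemma tendsto_tensor_iff:
  fixes x :: "nat \<Rightarrow> tensor"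
  shows "x \<longlonglongrightarrow> A \<longleftrightarrow> (\<forall>js. (\<lambda>m. x m js) \<longlonglongrightarrow> A js)"
proof -
  have "x \<longlonglongrightarrow> A \<longleftrightarrow> limitin (product_topology (\<lambda>_. euclidean) UNIV) x A sequentially"
    by (simp only: euclidean_product_topology limitin_canonical_iff)
  then show ?thesis by (simp only: limitin_componentwise limitin_canonical_iff) simp
qed

text \<open>The Moore-Penrose pseudoinverse is the unique solution of the four Penrose equations.\<close>

definition is_pinv :: "real mat \<Rightarrow> real mat \<Rightarrow> bool" where
  "is_pinv M P \<longleftrightarrow> P \<in> carrier_mat (dim_col M) (dim_row M) \<and>
     M * P * M = M \<and> P * M * P = P \<and>
     transpose_mat (M * P) = M * P \<and> transpose_mat (P * M) = P * M"

definition pinv :: "real mat \<Rightarrow> real mat" where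
  "pinv M = (THE P. is_pinv M P)"

lemma pinv_eqI:
  assumes P: "is_pinv M P" shows "pinv M = P"
  unfolding pinv_def
proof (rule the_equality, rule P)
  fix Q assume Q: "is_pinv M Q"
  define m n where "m = dim_row M" and "n = dim_col M"
  have M [simp]: "M \<in> carrier_mat m n" by (simp add: m_def n_def)
  have carP [simp]: "P \<in> carrier_mat n m" and carQ [simp]: "Q \<in> carrier_mat n m"
    using P Q by (auto simp: is_pinv_def m_def n_def)
  note pP = P[unfolded is_pinv_def] and pQ = Q[unfolded is_pinv_def]
  have MP [simp]: "M * P \<in> carrier_mat m m" "M * Q \<in> carrier_mat m m"
    and PM [simp]: "P * M \<in> carrier_mat n n" "Q * M \<in> carrier_mat n n"
    using mult_carrier_mat[OF M carP] mult_carrier_mat[OF M carQ]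
      mult_carrier_mat[OF carP M] mult_carrier_mat[OF carQ M] by auto
  have "(M * Q) * (M * P) = M * P"
    using assoc_mult_mat[OF MP(2) M carP] pQ by simp
  moreover have "transpose_mat ((M * Q) * (M * P)) = (M * P) * (M * Q)"
    using transpose_mult[OF MP(2) MP(1)] pP pQ by simp
  moreover have "(M * P) * (M * Q) = M * Q"
    using assoc_mult_mat[OF MP(1) M carQ] pP by simp
  ultimately have 1: "M * P = M * Q" using pP by simp
  have "(P * M) * (Q * M) = P * M"
    using assoc_mult_mat[OF carP M PM(2)] assoc_mult_mat[OF M carQ M] pQ by simp
  moreover have "transpose_mat ((P * M) * (Q * M)) = (Q * M) * (P * M)"
    using transpose_mult[OF PM(1) PM(2)] pP pQ by simp
  moreover have "(Q * M) * (P * M) = Q * M"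
    using assoc_mult_mat[OF carQ M PM(1)] assoc_mult_mat[OF M carP M] pP by simp
  ultimately have 2: "P * M = Q * M" using pP by simp
  have "Q = Q * M * Q" using pQ by simp
  also have "\<dots> = P * M * Q" by (simp add: 2)
  also have "\<dots> = P * (M * Q)" by (rule assoc_mult_mat[OF carP M carQ])
  also have "\<dots> = P * M * P" using assoc_mult_mat[OF carP M carP] by (simp add: 1)
  finally show "Q = P" using pP by simp
qed

definition projected_matricization ::
    "nat list \<Rightarrow> nat \<Rightarrow> real mat \<Rightarrow> real mat \<Rightarrow> tensor \<Rightarrow> real mat" where
  "projected_matricization ns i B C X =
     (1\<^sub>m (prod_list (take i ns)) - B * pinv B) * matricization ns i X *
     (1\<^sub>m (prod_list (drop i ns)) - pinv C * C)"

inductive tensor_polynomial :: "nat list \<Rightarrow> (tensor \<Rightarrow> real) \<Rightarrow> bool" for ns where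
  const: "tensor_polynomial ns (\<lambda>_. c)"
| coordinate: "js \<in> set (multi_indices ns) \<Longrightarrow> tensor_polynomial ns (\<lambda>X. X js)"
| add: "tensor_polynomial ns p \<Longrightarrow> tensor_polynomial ns q \<Longrightarrow> tensor_polynomial ns (\<lambda>X. p X + q X)"
| mult: "tensor_polynomial ns p \<Longrightarrow> tensor_polynomial ns q \<Longrightarrow> tensor_polynomial ns (\<lambda>X. p X * q X)"

text \<open>The \<open>(s i + 1) \<times> (s i + 1)\<close> minors of all projected matricizations, as functions of the tensor.\<close>

definition minor_system ::
    "nat list \<Rightarrow> (nat \<Rightarrow> nat) \<Rightarrow> (nat \<Rightarrow> real mat) \<Rightarrow> (nat \<Rightarrow> real mat) \<Rightarrow> (tensor \<Rightarrow> real) set" where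
  "minor_system ns s B C =
     {\<lambda>X. det (submatrix (projected_matricization ns i (B i) (C i) X) I J) | i I J.
        i \<in> {1..<length ns} \<and>
        I \<subseteq> {..<prod_list (take i ns)} \<and> card I = s i + 1 \<and>
        J \<subseteq> {..<prod_list (drop i ns)} \<and> card J = s i + 1}"

end

theory Submission imports Defs begin


text \<open>A matricization is an ordinary matrix, and at \<open>B C\<close> the tangent cone of a single rank condition
  is the stated projected rank condition. So the cone of the variety is contained in the right-hand
  side, and the point is to satisfy all conditions at once.

  For each \<open>i\<close> there is a linear pencil \<open>P\<^sub>i(t)\<close> of square matrices of rank at most \<open>k\<^sub>i + s\<^sub>i\<close> which
  fixes the \<open>i\<close>-th matricization of \<open>A + t X\<close> up to \<open>O(t\<^sup>2)\<close>. As in the truncation of a tensor by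
  successive singular value decompositions, apply \<open>P\<^bsub>d-1\<^esub>(t), \<dots>, P\<^sub>1(t)\<close> one after the other to
  \<open>A + t X\<close>: each application bounds one rank, and the later ones act by left multiplication on the
  matricizations treated before, so they do not increase these ranks. The result is a curve in the
  variety which agrees with \<open>A + t X\<close> up to \<open>o(t)\<close>. No compatibility between the \<open>P\<^sub>i\<close> is
  needed.\<close>

section \<open>Rank factorizations and minors\<close>

text \<open>The tangent cone of an intersection can be smaller than the intersection of the tangent
  cones: tangency to each rank variety alone yields one curve of matrices per \<open>i\<close>, and
  these need not come from a common curve of tensors. Producing each curve by an operator on the row
  index repairs this, because operators can be composed. Comparing powers of \<open>t\<close> in
  \<open>P(t) (A + t X) = A + t X + O(t^2)\<close> with \<open>P(t) = P0 + t P1\<close> gives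
  \<open>P0 A = A\<close> and \<open>P0 X + P1 A = X\<close>. The second equation is solvable for
  \<open>P1\<close> only if \<open>X - P0 X\<close> vanishes on the kernel of \<open>A\<close>, that
  is, if \<open>P0\<close> fixes the columns of \<open>X R\<close>. The columns of \<open>A\<close>
  and of \<open>X R\<close> together span a space of dimension \<open>k + rank (L X R)\<close>,
  which is where the projected rank comes from. Each operator converges as \<open>t\<close> tends to
  0, so it maps an error \<open>o(t)\<close> to an error \<open>o(t)\<close>, and the errors of the
  successive steps merely add up.\<close>

definition indep_cols :: "real mat \<Rightarrow> nat set \<Rightarrow> bool" where
  "indep_cols M J \<longleftrightarrow> J \<subseteq> {..<dim_col M} \<and>
     (\<forall>c. (\<forall>i<dim_row M. (\<Sum>j\<in>J. M $$ (i, j) * c j) = 0) \<longrightarrow> (\<forall>j\<in>J. c j = 0))"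

text \<open>Bounding the rank by a factorization turns the estimates for products, sums and
  transposes into manipulations of the two factors. The inner dimension is exactly \<open>r\<close>,
  so enlarging the bound means padding with zeros.\<close>

definition low_rank :: "real mat \<Rightarrow> nat \<Rightarrow> bool" where
  "low_rank M r \<longleftrightarrow>
     (\<exists>U \<in> carrier_mat (dim_row M) r. \<exists>V \<in> carrier_mat r (dim_col M). M = U * V)"

lemma indep_cols_finite: "indep_cols M J \<Longrightarrow> finite J"
  by (meson finite_lessThan finite_subset indep_cols_def)

text \<open>The rank of the library counts column vectors, while \<open>indep_cols\<close> counts
  column positions. Two equal columns at different positions would be dependent with coefficients 1
  and -1, so passing from positions to vectors loses nothing.\<close>

lemma indep_cols_rank_le:
  assumes "indep_cols M J"
  shows "card J \<le> mat_rank M"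
proof -
  define m n where "m = dim_row M" and "n = dim_col M"
  have M: "M \<in> carrier_mat m n" by (simp add: m_def n_def)
  interpret vec_space "TYPE(real)" m .
  have J: "J \<subseteq> {..<n}" and fin: "finite J"
    using assms indep_cols_finite[OF assms] by (auto simp: indep_cols_def n_def)
  have ind: "c j = 0" if "\<And>i. i < m \<Longrightarrow> (\<Sum>j\<in>J. M $$ (i, j) * c j) = 0" "j \<in> J" for c j
    using assms that by (auto simp: indep_cols_def m_def)
  have inj: "inj_on (col M) J"
  proof (rule inj_onI, rule ccontr)
    fix a b assume ab: "a \<in> J" "b \<in> J" "col M a = col M b" "a \<noteq> b"
    define c :: "nat \<Rightarrow> real" where "c j = (if j = a then 1 else if j = b then -1 else 0)" for j
    have "(\<Sum>j\<in>J. M $$ (i, j) * c j) = 0" if "i < m" for i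
    proof -
      have "(\<Sum>j\<in>J. M $$ (i, j) * c j) = (\<Sum>j\<in>{a, b}. M $$ (i, j) * c j)"
        using fin ab by (intro sum.mono_neutral_right) (auto simp: c_def)
      also have "\<dots> = M $$ (i, a) - M $$ (i, b)" using ab by (simp add: c_def)
      also have "M $$ (i, a) = col M a $ i"
        by (rule index_col[symmetric]) (use ab J that M in auto)
      also have "M $$ (i, b) = col M b $ i"
        by (rule index_col[symmetric]) (use ab J that M in auto)
      finally show ?thesis using ab by simp
    qed
    from ind[OF this ab(1)] show False by (simp add: c_def)
  qed
  let ?S = "col M ` J"
  have Sc: "?S \<subseteq> carrier_vec m" using M by auto
  have sub: "?S \<subseteq> set (cols M)" using J M by (auto simp: cols_def)
  have "lin_indpt ?S"
  proof
    assume "lin_dep ?S"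
    then obtain a w where a: "lincomb a ?S = 0\<^sub>v m" "w \<in> ?S" "a w \<noteq> 0"
      using finite_lin_dep[of ?S] fin Sc by auto
    have "(\<Sum>j\<in>J. M $$ (i, j) * a (col M j)) = 0" if "i < m" for i
    proof -
      have "0 = lincomb a ?S $ i" using a that by simp
      also have "\<dots> = (\<Sum>x\<in>?S. a x * x $ i)" by (rule lincomb_index[OF that Sc])
      also have "\<dots> = (\<Sum>j\<in>J. a (col M j) * col M j $ i)"
        by (simp add: sum.reindex[OF inj])
      also have "\<dots> = (\<Sum>j\<in>J. M $$ (i, j) * a (col M j))"
        using J that M by (intro sum.cong) (auto simp: mult.commute)
      finally show ?thesis by simp
    qed
    from ind[OF this] a show False by auto
  qed
  from rank_ge_card_indpt[OF M sub this] show ?thesis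
    using M by (simp add: card_image[OF inj] mat_rank_def)
qed

text \<open>A maximal independent set of column vectors has as many elements as the rank;
  \<open>J\<close> picks one position for each of them.\<close>

lemma indep_cols_exists:
  obtains J where "indep_cols M J" "card J = mat_rank M"
proof -
  define m n where "m = dim_row M" and "n = dim_col M"
  have M: "M \<in> carrier_mat m n" by (simp add: m_def n_def)
  interpret vec_space "TYPE(real)" m .
  obtain S where S: "maximal S (\<lambda>T. T \<subseteq> set (cols M) \<and> lin_indpt T)"
    using maximal_exists[of "(\<lambda>T. T \<subseteq> set (cols M) \<and> lin_indpt T)" "card (set (cols M))" "{}"]
    by (meson List.finite_set card_mono empty_iff empty_subsetI finite_lin_indpt2 rev_finite_subset)
  have Ss: "S \<subseteq> set (cols M)" and Si: "lin_indpt S" using S by (auto simp: maximal_def)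
  have Sc: "S \<subseteq> carrier_vec m" using Ss cols_dim M by blast
  have fS: "finite S" using Ss finite_subset by blast
  have r: "mat_rank M = card S" using rank_card_indpt[OF M S] M by (simp add: mat_rank_def)
  have "S \<subseteq> col M ` {..<n}" using Ss M by (auto simp: cols_def)
  then obtain J where J: "J \<subseteq> {..<n}" "S = col M ` J" "inj_on (col M) J"
    by (meson subset_image_inj)
  have "c j = 0" if z: "\<And>i. i < m \<Longrightarrow> (\<Sum>j\<in>J. M $$ (i, j) * c j) = 0" and j: "j \<in> J" for c j
  proof (rule ccontr)
    assume nz: "c j \<noteq> 0"
    define a where "a x = c (the_inv_into J (col M) x)" for x
    have a: "a (col M j) = c j" if "j \<in> J" for j
      by (simp add: a_def the_inv_into_f_f[OF J(3) that])
    have "lincomb a S = 0\<^sub>v m"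
    proof (rule eq_vecI)
      have "lincomb a S \<in> carrier_vec m" using Sc by (intro lincomb_closed) auto
      then show "dim_vec (lincomb a S) = dim_vec (0\<^sub>v m :: real vec)" by simp
      fix i assume "i < dim_vec (0\<^sub>v m :: real vec)" then have i: "i < m" by simp
      have "lincomb a S $ i = (\<Sum>x\<in>S. a x * x $ i)" by (rule lincomb_index[OF i Sc])
      also have "\<dots> = (\<Sum>j\<in>J. a (col M j) * col M j $ i)"
        unfolding J(2) by (simp add: sum.reindex[OF J(3)])
      also have "\<dots> = (\<Sum>j\<in>J. M $$ (i, j) * c j)"
        using J i M by (intro sum.cong) (auto simp: mult.commute a)
      finally show "lincomb a S $ i = 0\<^sub>v m $ i" using z[OF i] i by simp
    qed
    moreover have "col M j \<in> S" "a (col M j) \<noteq> 0" using j J nz a by auto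
    ultimately have "lin_dep S"
      using lin_dep_crit[OF fS order_refl, where a = a and v = "col M j"] by auto
    with Si show False by simp
  qed
  then have "indep_cols M J" using J M by (auto simp: indep_cols_def)
  moreover have "card J = mat_rank M" using J r by (simp add: card_image)
  ultimately show thesis by (rule that)
qed

text \<open>\<open>U\<close> consists of the columns of \<open>M\<close> at a largest independent
  set \<open>J\<close>, and \<open>V\<close> holds the coefficients of all columns with respect to
  them. They exist because adding a further position to \<open>J\<close> would exceed the rank and
  hence creates a dependency.\<close>

lemma rank_factorization:
  obtains U V where "U \<in> carrier_mat (dim_row M) (mat_rank M)"
    "V \<in> carrier_mat (mat_rank M) (dim_col M)" "M = U * V"
proof -
  define m n where "m = dim_row M" and "n = dim_col M"
  obtain J where J: "indep_cols M J" and cJ: "card J = mat_rank M" by (rule indep_cols_exists)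
  note fin = indep_cols_finite[OF J]
  obtain f where f: "bij_betw f {..<mat_rank M} J"
    using ex_bij_betw_nat_finite[OF fin] cJ by (auto simp: atLeast0LessThan)
  have "\<exists>d. \<forall>i<m. M $$ (i, j) = (\<Sum>l\<in>J. M $$ (i, l) * d l)" if j: "j < n" for j
  proof (cases "j \<in> J")
    case True
    then have "\<forall>i<m. M $$ (i, j) = (\<Sum>l\<in>J. M $$ (i, l) * (if l = j then 1 else 0))"
      using fin by (simp add: sum.delta if_distrib cong: if_cong)
    then show ?thesis by (intro exI[of _ "\<lambda>l. if l = j then 1 else 0"])
  next
    case False
    then have "\<not> indep_cols M (insert j J)"
      using indep_cols_rank_le[of M "insert j J"] fin cJ by auto
    then obtain c where c: "\<And>i. i < m \<Longrightarrow> (\<Sum>l\<in>insert j J. M $$ (i, l) * c l) = 0"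
      and nz: "\<exists>l\<in>insert j J. c l \<noteq> 0"
      using J j by (auto simp: indep_cols_def m_def n_def)
    have cj: "c j \<noteq> 0"
    proof
      assume 0: "c j = 0"
      then have "(\<Sum>l\<in>J. M $$ (i, l) * c l) = 0" if "i < m" for i
        using c[OF that] False fin by simp
      then have "\<forall>l\<in>J. c l = 0" using J by (simp add: indep_cols_def m_def)
      with nz 0 show False by auto
    qed
    have "M $$ (i, j) = (\<Sum>l\<in>J. M $$ (i, l) * (- c l / c j))" if "i < m" for i
    proof -
      have "M $$ (i, j) * c j = - (\<Sum>l\<in>J. M $$ (i, l) * c l)"
        using c[OF that] False fin by simp
      then have "M $$ (i, j) = - (\<Sum>l\<in>J. M $$ (i, l) * c l) / c j"
        using cj by (simp add: field_simps)
      then show ?thesis by (simp add: sum_divide_distrib sum_negf)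
    qed
    then show ?thesis by (intro exI[of _ "\<lambda>l. - c l / c j"]) simp
  qed
  then obtain d where d: "\<And>j i. j < n \<Longrightarrow> i < m \<Longrightarrow> M $$ (i, j) = (\<Sum>l\<in>J. M $$ (i, l) * d j l)"
    by metis
  let ?U = "mat m (mat_rank M) (\<lambda>(i, l). M $$ (i, f l))"
  let ?V = "mat (mat_rank M) n (\<lambda>(l, j). d j (f l))"
  have "M = ?U * ?V"
  proof (rule eq_matI)
    fix i j assume "i < dim_row (?U * ?V)" "j < dim_col (?U * ?V)"
    then have ij: "i < m" "j < n" by auto
    have "(?U * ?V) $$ (i, j) = (\<Sum>l<mat_rank M. M $$ (i, f l) * d j (f l))"
      using ij by (simp add: scalar_prod_def atLeast0LessThan)
    also have "\<dots> = (\<Sum>l\<in>J. M $$ (i, l) * d j l)" by (rule sum.reindex_bij_betw[OF f])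
    finally show "M $$ (i, j) = (?U * ?V) $$ (i, j)" using d ij by simp
  qed (auto simp: m_def n_def)
  then show thesis by (intro that[of ?U ?V]) (auto simp: m_def n_def)
qed

lemma indep_cols_reindex:
  assumes J: "indep_cols M J" and f: "bij_betw f {..<q} J"
    and z: "\<And>i. i < dim_row M \<Longrightarrow> (\<Sum>j<q. M $$ (i, f j) * x j) = 0" and j: "j < q"
  shows "x j = 0"
proof -
  define c where "c j = x (the_inv_into {..<q} f j)" for j
  have c: "c (f j) = x j" if "j < q" for j
    using f that by (simp add: c_def the_inv_into_f_f bij_betw_def)
  have "(\<Sum>j\<in>J. M $$ (i, j) * c j) = 0" if "i < dim_row M" for i
  proof -
    have "(\<Sum>j\<in>J. M $$ (i, j) * c j) = (\<Sum>j<q. M $$ (i, f j) * c (f j))"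
      by (rule sum.reindex_bij_betw[OF f, symmetric])
    then show ?thesis using z[OF that] by (simp add: c)
  qed
  then have "\<forall>j\<in>J. c j = 0" using J by (auto simp: indep_cols_def)
  then show ?thesis using c[OF j] f j by (auto simp: bij_betw_def)
qed

text \<open>More than \<open>r\<close> independent columns of \<open>U * V\<close> would select more
  than \<open>r\<close> columns of \<open>V\<close>, which has only \<open>r\<close> rows; a linear
  relation among these is inherited by the product.\<close>

lemma mat_rank_le_if_mult:
  assumes U: "U \<in> carrier_mat m r" and V: "V \<in> carrier_mat r n"
  shows "mat_rank (U * V) \<le> r"
proof (rule ccontr)
  assume "\<not> ?thesis"
  then have less: "r < mat_rank (U * V)" by simp
  obtain J where J: "indep_cols (U * V) J" and cJ: "card J = mat_rank (U * V)"
    by (rule indep_cols_exists)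
  define q where "q = mat_rank (U * V)"
  have Jn: "J \<subseteq> {..<n}" using J V by (auto simp: indep_cols_def)
  obtain f where f: "bij_betw f {..<q} J"
    using ex_bij_betw_nat_finite[OF indep_cols_finite[OF J]] cJ
    by (auto simp: atLeast0LessThan q_def)
  have "r < q" using less by (simp add: q_def)
  \<comment> \<open>The selected columns of \<open>V\<close> are padded with zero rows to a square
    matrix, so that the relation is a kernel vector of a matrix with determinant 0. Row
    \<open>r\<close> is one of the added rows because \<open>r < q\<close>.\<close>
  define W where "W = mat q q (\<lambda>(l, j). if l < r then V $$ (l, f j) else 0)"
  have W: "W \<in> carrier_mat q q" by (simp add: W_def)
  have "W = mat\<^sub>r q q (\<lambda>i. if i = r then 0\<^sub>v q else row W i)"
    by (rule eq_matI) (auto simp: W_def)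
  moreover have "det (mat\<^sub>r q q (\<lambda>i. if i = r then 0\<^sub>v q else row W i)) = 0"
    by (rule det_row_0) (use \<open>r < q\<close> W in auto)
  ultimately have "det W = 0" by simp
  then obtain x where x: "x \<in> carrier_vec q" "x \<noteq> 0\<^sub>v q" "W *\<^sub>v x = 0\<^sub>v q"
    using det_0_iff_vec_prod_zero_field[OF W] by auto
  have Vx: "(\<Sum>j<q. V $$ (l, f j) * x $ j) = 0" if "l < r" for l
  proof -
    have "(W *\<^sub>v x) $ l = (\<Sum>j<q. V $$ (l, f j) * x $ j)"
      using that \<open>r < q\<close> x(1) by (simp add: W_def scalar_prod_def atLeast0LessThan)
    then show ?thesis using x(3) that \<open>r < q\<close> by simp
  qed
  have "x $ j = 0" if j: "j < q" for j
  proof (rule indep_cols_reindex[OF J f _ j])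
    fix i assume "i < dim_row (U * V)"
    then have i: "i < m" using U by simp
    have fn: "f j < n" if "j < q" for j using f that Jn by (auto simp: bij_betw_def)
    have "(\<Sum>j<q. (U * V) $$ (i, f j) * x $ j) =
        (\<Sum>j<q. (\<Sum>l<r. U $$ (i, l) * V $$ (l, f j)) * x $ j)"
      using i U V fn by (intro sum.cong) (auto simp: scalar_prod_def atLeast0LessThan)
    also have "\<dots> = (\<Sum>l<r. U $$ (i, l) * (\<Sum>j<q. V $$ (l, f j) * x $ j))"
      unfolding sum_distrib_right sum_distrib_left mult.assoc by (rule sum.swap)
    also have "\<dots> = 0" using Vx by simp
    finally show "(\<Sum>j<q. (U * V) $$ (i, f j) * x $ j) = 0" .
  qed
  then have "x = 0\<^sub>v q" using x(1) by (intro eq_vecI) auto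
  with x show False by simp
qed

section \<open>Closure properties of rank bounds\<close>

lemma low_rankI:
  "U \<in> carrier_mat m r \<Longrightarrow> V \<in> carrier_mat r n \<Longrightarrow> low_rank (U * V) r"
  unfolding low_rank_def by auto

lemma low_rank_mono:
  assumes "low_rank M r" "r \<le> s"
  shows "low_rank M s"
proof -
  obtain U V where U: "U \<in> carrier_mat (dim_row M) r" and V: "V \<in> carrier_mat r (dim_col M)"
    and M: "M = U * V" using assms by (auto simp: low_rank_def)
  let ?U = "mat (dim_row M) s (\<lambda>(i, l). if l < r then U $$ (i, l) else 0)"
  let ?V = "mat s (dim_col M) (\<lambda>(l, j). if l < r then V $$ (l, j) else 0)"
  have "M = ?U * ?V"
  proof (rule eq_matI)
    fix i j assume "i < dim_row (?U * ?V)" "j < dim_col (?U * ?V)"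
    then have ij: "i < dim_row M" "j < dim_col M" by auto
    have "(?U * ?V) $$ (i, j) = (\<Sum>l<s. if l < r then U $$ (i, l) * V $$ (l, j) else 0)"
      using ij by (auto simp: scalar_prod_def atLeast0LessThan intro!: sum.cong)
    also have "\<dots> = (\<Sum>l<r. U $$ (i, l) * V $$ (l, j))"
      using assms(2) by (intro sum.mono_neutral_cong_right) auto
    also have "\<dots> = (U * V) $$ (i, j)"
      using U V ij by (simp add: scalar_prod_def atLeast0LessThan)
    finally show "M $$ (i, j) = (?U * ?V) $$ (i, j)" using M by simp
  qed auto
  then show ?thesis
    using low_rankI[of ?U "dim_row M" s ?V "dim_col M"] by simp
qed

lemma mat_rank_le_iff: "mat_rank M \<le> r \<longleftrightarrow> low_rank M r"
proof
  assume "mat_rank M \<le> r"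
  moreover have "low_rank M (mat_rank M)"
    using rank_factorization[of M] unfolding low_rank_def by blast
  ultimately show "low_rank M r" by (rule low_rank_mono[rotated])
next
  assume "low_rank M r"
  then show "mat_rank M \<le> r" by (metis low_rank_def mat_rank_le_if_mult)
qed

lemma low_rank_transpose:
  assumes "low_rank M r"
  shows "low_rank (transpose_mat M) r"
proof -
  obtain U V where U: "U \<in> carrier_mat (dim_row M) r" and V: "V \<in> carrier_mat r (dim_col M)"
    and M: "M = U * V" using assms by (auto simp: low_rank_def)
  have "transpose_mat M = transpose_mat V * transpose_mat U"
    using transpose_mult[OF U V] M by simp
  then show ?thesis
    using low_rankI[of "transpose_mat V" "dim_col M" r "transpose_mat U" "dim_row M"] U V by simp
qed

lemma low_rank_mult_left:
  assumes "low_rank M r" "P \<in> carrier_mat p (dim_row M)"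
  shows "low_rank (P * M) r"
proof -
  obtain U V where U: "U \<in> carrier_mat (dim_row M) r" and V: "V \<in> carrier_mat r (dim_col M)"
    and M: "M = U * V" using assms by (auto simp: low_rank_def)
  have "P * M = (P * U) * V" using assoc_mult_mat[OF assms(2) U V] M by simp
  then show ?thesis using low_rankI[OF mult_carrier_mat[OF assms(2) U] V] by simp
qed

lemma low_rank_mult_right:
  assumes "low_rank M r" "Q \<in> carrier_mat (dim_col M) q"
  shows "low_rank (M * Q) r"
proof -
  obtain U V where U: "U \<in> carrier_mat (dim_row M) r" and V: "V \<in> carrier_mat r (dim_col M)"
    and M: "M = U * V" using assms by (auto simp: low_rank_def)
  have "M * Q = U * (V * Q)" using assoc_mult_mat[OF U V assms(2)] M by simp
  then show ?thesis using low_rankI[OF U mult_carrier_mat[OF V assms(2)]] by simp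
qed

lemma low_rank_add:
  assumes M: "low_rank M r" and N: "low_rank N s"
    and dim: "dim_row N = dim_row M" "dim_col N = dim_col M"
  shows "low_rank (M + N) (r + s)"
proof -
  obtain U V where U: "U \<in> carrier_mat (dim_row M) r" and V: "V \<in> carrier_mat r (dim_col M)"
    and M: "M = U * V" using M by (auto simp: low_rank_def)
  obtain U' V' where U': "U' \<in> carrier_mat (dim_row M) s" and V': "V' \<in> carrier_mat s (dim_col M)"
    and N: "N = U' * V'" using N dim by (auto simp: low_rank_def)
  \<comment> \<open>The block factors: \<open>U\<close> next to \<open>U'\<close>, and
    \<open>V\<close> on top of \<open>V'\<close>.\<close>
  let ?U = "mat (dim_row M) (r + s) (\<lambda>(i, l). if l < r then U $$ (i, l) else U' $$ (i, l - r))"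
  let ?V = "mat (r + s) (dim_col M) (\<lambda>(l, j). if l < r then V $$ (l, j) else V' $$ (l - r, j))"
  have "M + N = ?U * ?V"
  proof (rule eq_matI)
    fix i j assume "i < dim_row (?U * ?V)" "j < dim_col (?U * ?V)"
    then have ij: "i < dim_row M" "j < dim_col M" by auto
    let ?g = "\<lambda>l. if l < r then U $$ (i, l) * V $$ (l, j) else U' $$ (i, l - r) * V' $$ (l - r, j)"
    have "(?U * ?V) $$ (i, j) = (\<Sum>l=0..<r + s. ?g l)"
      using ij by (auto simp: scalar_prod_def intro!: sum.cong)
    also have "\<dots> = (\<Sum>l=0..<r. ?g l) + (\<Sum>l=r..<r + s. ?g l)"
      by (rule sum.atLeastLessThan_concat[symmetric]) auto
    also have "(\<Sum>l=r..<r + s. ?g l) = (\<Sum>l=0..<s. ?g (l + r))"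
      using sum.shift_bounds_nat_ivl[of ?g 0 r s] by (simp add: add.commute)
    also have "\<dots> = (U' * V') $$ (i, j)" using U' V' ij by (simp add: scalar_prod_def)
    also have "(\<Sum>l=0..<r. ?g l) = (U * V) $$ (i, j)" using U V ij by (simp add: scalar_prod_def)
    finally show "(M + N) $$ (i, j) = (?U * ?V) $$ (i, j)"
      using ij dim unfolding M N by simp
  qed (use dim in auto)
  then show ?thesis
    using low_rankI[of ?U "dim_row M" "r + s" ?V "dim_col M"] by simp
qed


section \<open>Row rank, column rank and minors\<close>

lemma mat_rank_transpose: "mat_rank (transpose_mat M) = mat_rank M"
proof (rule antisym)
  show le: "mat_rank (transpose_mat M) \<le> mat_rank M" for M
    using low_rank_transpose[of M "mat_rank M"] by (simp add: mat_rank_le_iff[symmetric])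
  show "mat_rank M \<le> mat_rank (transpose_mat M)" using le[of "transpose_mat M"] by simp
qed

lemma indep_cols_subset:
  assumes "indep_cols M J" "K \<subseteq> J"
  shows "indep_cols M K"
  unfolding indep_cols_def
proof (intro conjI allI impI ballI)
  show "K \<subseteq> {..<dim_col M}" using assms by (auto simp: indep_cols_def)
  fix c j assume z: "\<forall>i<dim_row M. (\<Sum>j\<in>K. M $$ (i, j) * c j) = 0" and j: "j \<in> K"
  let ?c = "\<lambda>j. if j \<in> K then c j else 0"
  have "(\<Sum>j\<in>J. M $$ (i, j) * ?c j) = (\<Sum>j\<in>K. M $$ (i, j) * c j)" for i
    using assms indep_cols_finite[OF assms(1)] by (intro sum.mono_neutral_cong_right) auto
  with z have "\<forall>i<dim_row M. (\<Sum>j\<in>J. M $$ (i, j) * ?c j) = 0" by simp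
  moreover have "(\<forall>i<dim_row M. (\<Sum>j\<in>J. M $$ (i, j) * ?c j) = 0) \<longrightarrow> (\<forall>j\<in>J. ?c j = 0)"
    using assms(1) unfolding indep_cols_def by (elim conjE allE)
  moreover have "j \<in> J" using j assms(2) by (rule subsetD[rotated])
  ultimately have "?c j = 0" by blast
  then show "c j = 0" using j by simp
qed

lemma pick_bij_betw:
  assumes "finite J"
  shows "bij_betw (pick J) {..<card J} J"
proof -
  have inj: "inj_on (pick J) {..<card J}"
  proof (rule linorder_inj_onI)
    fix x y assume "x < y" "y \<in> {..<card J}"
    then have "pick J x < pick J y" using pick_mono_le[of y J x] by simp
    then show "pick J x \<noteq> pick J y" by simp
  qed auto
  moreover have "pick J ` {..<card J} \<subseteq> J" by (auto intro: pick_in_set_le)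
  ultimately show ?thesis
    using assms by (simp add: bij_betw_def card_image card_subset_eq)
qed

text \<open>First \<open>q\<close> independent columns are kept. The thinned matrix \<open>W\<close>
  has rank at least \<open>q\<close>, hence also \<open>q\<close> independent rows. The square
  matrix on these rows and columns has a transpose with trivial kernel.\<close>

lemma nonzero_minor_exists:
  assumes "q \<le> mat_rank M"
  obtains I J where "I \<subseteq> {..<dim_row M}" "card I = q" "J \<subseteq> {..<dim_col M}" "card J = q"
    "det (submatrix M I J) \<noteq> 0"
proof -
  define m where "m = dim_row M"
  obtain J0 where J0: "indep_cols M J0" "card J0 = mat_rank M" by (rule indep_cols_exists)
  have "q \<le> card J0" using assms J0(2) by simp
  then obtain J where J: "J \<subseteq> J0" "card J = q"
    by (rule obtain_subset_with_card_n)
  have JM: "indep_cols M J" using indep_cols_subset[OF J0(1) J(1)] .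
  note bJ = pick_bij_betw[OF indep_cols_finite[OF JM], unfolded J(2)]
  define W where "W = mat m q (\<lambda>(i, j). M $$ (i, pick J j))"
  have W: "W \<in> carrier_mat m q" by (simp add: W_def)
  have "indep_cols W {..<q}"
    unfolding indep_cols_def
  proof (intro conjI allI impI ballI)
    show "{..<q} \<subseteq> {..<dim_col W}" using W by simp
    fix c j assume z: "\<forall>i<dim_row W. (\<Sum>j<q. W $$ (i, j) * c j) = 0" and j: "j \<in> {..<q}"
    show "c j = 0"
    proof (rule indep_cols_reindex[OF JM bJ])
      fix i assume i: "i < dim_row M"
      have "(\<Sum>j<q. W $$ (i, j) * c j) = (\<Sum>j<q. M $$ (i, pick J j) * c j)"
        using i by (intro sum.cong) (auto simp: W_def m_def)
      then show "(\<Sum>j<q. M $$ (i, pick J j) * c j) = 0" using z i W by (simp add: m_def)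
    qed (use j in auto)
  qed
  from indep_cols_rank_le[OF this] have "q \<le> mat_rank W" by simp
  then have rW: "q \<le> mat_rank (transpose_mat W)" by (simp add: mat_rank_transpose)
  obtain I0 where I0: "indep_cols (transpose_mat W) I0" "card I0 = mat_rank (transpose_mat W)"
    by (rule indep_cols_exists)
  have "q \<le> card I0" using rW I0(2) by simp
  then obtain I where I: "I \<subseteq> I0" "card I = q"
    by (rule obtain_subset_with_card_n)
  have IW: "indep_cols (transpose_mat W) I" using indep_cols_subset[OF I0(1) I(1)] .
  note bI = pick_bij_betw[OF indep_cols_finite[OF IW], unfolded I(2)]
  have Im: "I \<subseteq> {..<m}" using IW W by (auto simp: indep_cols_def)
  have Jn: "J \<subseteq> {..<dim_col M}" using JM by (auto simp: indep_cols_def)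
  have "{i. i < dim_row M \<and> i \<in> I} = I" "{j. j < dim_col M \<and> j \<in> J} = J"
    using Im Jn by (auto simp: m_def)
  then have cards: "card {i. i < dim_row M \<and> i \<in> I} = q" "card {j. j < dim_col M \<and> j \<in> J} = q"
    using I(2) J(2) by simp_all
  define D where "D = submatrix M I J"
  have D: "D \<in> carrier_mat q q" 
    by (rule carrier_matI) (simp_all only: D_def dim_submatrix cards)
  have DW: "D $$ (i, j) = transpose_mat W $$ (j, pick I i)" if "i < q" "j < q" for i j
  proof -
    have "pick I i \<in> I" using that bI by (auto simp: bij_betw_def)
    then have "pick I i < m" using Im by auto
    then show ?thesis using that by (simp add: D_def submatrix_index cards W_def)
  qed
  have "det (transpose_mat D) \<noteq> 0"
  proof
    assume "det (transpose_mat D) = 0"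
    moreover have DT: "transpose_mat D \<in> carrier_mat q q" using D by simp
    ultimately obtain x where x: "x \<in> carrier_vec q" "x \<noteq> 0\<^sub>v q" "transpose_mat D *\<^sub>v x = 0\<^sub>v q"
      using det_0_iff_vec_prod_zero_field[OF DT] by auto
    have "x $ i = 0" if i: "i < q" for i
    proof (rule indep_cols_reindex[OF IW bI])
      fix j assume "j < dim_row (transpose_mat W)"
      then have j: "j < q" using W by simp
      have "0 = (transpose_mat D *\<^sub>v x) $ j" using x(3) j by simp
      also have "\<dots> = (\<Sum>i<q. D $$ (i, j) * x $ i)"
        using j D x(1) by (simp add: scalar_prod_def atLeast0LessThan)
      finally show "(\<Sum>i<q. transpose_mat W $$ (j, pick I i) * x $ i) = 0"
        using j DW by simp
    qed (use i in auto)
    then have "x = 0\<^sub>v q" using x(1) by (intro eq_vecI) auto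
    with x show False by simp
  qed
  then have "det (submatrix M I J) \<noteq> 0"
    unfolding D_def[symmetric] by (simp only: det_transpose[OF D] not_False_eq_True)
  with Im I(2) Jn J(2) show thesis unfolding m_def by (rule that)
qed

text \<open>Needed twice: vanishing minors survive limits, and they are the polynomial system of the
  theorem. If \<open>s + 1\<close> exceeds a dimension, no \<open>I\<close> or \<open>J\<close>
  qualifies and both sides hold.\<close>

lemma mat_rank_le_iff_minors:
  "mat_rank M \<le> s \<longleftrightarrow> (\<forall>I J. I \<subseteq> {..<dim_row M} \<and> card I = s + 1 \<and>
     J \<subseteq> {..<dim_col M} \<and> card J = s + 1 \<longrightarrow> det (submatrix M I J) = 0)"
proof
  assume r: "mat_rank M \<le> s"
  show "\<forall>I J. I \<subseteq> {..<dim_row M} \<and> card I = s + 1 \<and>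
     J \<subseteq> {..<dim_col M} \<and> card J = s + 1 \<longrightarrow> det (submatrix M I J) = 0"
  proof (intro allI impI, rule ccontr)
    fix I J
    assume IJ: "I \<subseteq> {..<dim_row M} \<and> card I = s + 1 \<and> J \<subseteq> {..<dim_col M} \<and> card J = s + 1"
      and "det (submatrix M I J) \<noteq> 0"
    moreover have "M \<in> carrier_mat (dim_row M) (dim_col M)" by simp
    ultimately have "card {j. j < dim_col M \<and> j \<in> J} \<le> mat_rank M"
      unfolding mat_rank_def by (intro vec_space.rank_gt_minor)
    moreover have "{j. j < dim_col M \<and> j \<in> J} = J" using IJ by auto
    ultimately show False using r IJ by simp
  qed
next
  assume *: "\<forall>I J. I \<subseteq> {..<dim_row M} \<and> card I = s + 1 \<and>
     J \<subseteq> {..<dim_col M} \<and> card J = s + 1 \<longrightarrow> det (submatrix M I J) = 0"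
  show "mat_rank M \<le> s"
  proof (rule ccontr)
    assume "\<not> mat_rank M \<le> s"
    then have "s + 1 \<le> mat_rank M" by simp
    then obtain I J where "I \<subseteq> {..<dim_row M}" "card I = s + 1"
      "J \<subseteq> {..<dim_col M}" "card J = s + 1" "det (submatrix M I J) \<noteq> 0"
      by (rule nonzero_minor_exists)
    with * show False by blast
  qed
qed

section \<open>Pseudoinverses of matrices of full rank\<close>

text \<open>Variants of the ring laws with dimension equations instead of carriers, which the simplifier
  can discharge.\<close>

lemma mult_mat_assoc_dim:
  "dim_col A = dim_row B \<Longrightarrow> dim_col B = dim_row C \<Longrightarrow> (A * B) * C = A * (B * C :: real mat)"
  by (rule assoc_mult_mat[of A "dim_row A" "dim_row B" B "dim_row C" C "dim_col C"]) auto

lemma mult_minus_distrib_dim: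
  "dim_col A = dim_row B \<Longrightarrow> dim_row C = dim_row B \<Longrightarrow> dim_col C = dim_col B \<Longrightarrow>
    A * (B - C) = A * B - A * (C :: real mat)"
  by (rule mult_minus_distrib_mat[of A "dim_row A" "dim_row B" B "dim_col B" C]) auto

lemma minus_mult_distrib_dim:
  "dim_col A = dim_row C \<Longrightarrow> dim_row B = dim_row A \<Longrightarrow> dim_col B = dim_col A \<Longrightarrow>
    (A - B) * C = A * C - B * (C :: real mat)"
  by (rule minus_mult_distrib_mat[of A "dim_row A" "dim_row C" B C "dim_col C"]) auto

lemma mult_add_distrib_dim:
  "dim_col A = dim_row B \<Longrightarrow> dim_row C = dim_row B \<Longrightarrow> dim_col C = dim_col B \<Longrightarrow>
    A * (B + C) = A * B + A * (C :: real mat)"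
  by (rule mult_add_distrib_mat[of A "dim_row A" "dim_row B" B "dim_col B" C]) auto

lemma add_mult_distrib_dim:
  "dim_col A = dim_row C \<Longrightarrow> dim_row B = dim_row A \<Longrightarrow> dim_col B = dim_col A \<Longrightarrow>
    (A + B) * C = A * C + B * (C :: real mat)"
  by (rule add_mult_distrib_mat[of A "dim_row A" "dim_row C" B C "dim_col C"]) auto

lemma one_mult_dim: "dim_row A = n \<Longrightarrow> 1\<^sub>m n * A = (A :: real mat)"
  and mult_one_dim: "dim_col A = n \<Longrightarrow> A * 1\<^sub>m n = (A :: real mat)"
  by auto

lemmas mat_dim_simps = mult_mat_assoc_dim mult_minus_distrib_dim minus_mult_distrib_dim
  mult_add_distrib_dim add_mult_distrib_dim one_mult_dim mult_one_dim

lemma full_col_rank_kernel: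
  assumes U: "U \<in> carrier_mat m r" and r: "r \<le> mat_rank U"
    and x: "x \<in> carrier_vec r" "U *\<^sub>v x = 0\<^sub>v m"
  shows "x = 0\<^sub>v r"
proof -
  obtain J where J: "indep_cols U J" "card J = mat_rank U" by (rule indep_cols_exists)
  have "J \<subseteq> {..<r}" using J U by (auto simp: indep_cols_def)
  moreover have "card {..<r} \<le> card J" using J r by simp
  ultimately have "J = {..<r}" by (metis card_seteq finite_lessThan)
  then have ind: "indep_cols U {..<r}" using J by simp
  have "(\<Sum>j<r. U $$ (i, j) * x $ j) = 0" if "i < m" for i
  proof -
    have "(U *\<^sub>v x) $ i = (\<Sum>j<r. U $$ (i, j) * x $ j)"
      using U x(1) that by (simp add: scalar_prod_def atLeast0LessThan)
    then show ?thesis using x(2) that by simp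
  qed
  then have "\<forall>j\<in>{..<r}. x $ j = 0" using ind U by (auto simp: indep_cols_def)
  then show ?thesis using x(1) by (intro eq_vecI) auto
qed

lemma pinv_full_col_rank_exists:
  assumes U: "U \<in> carrier_mat m r" and r: "r \<le> mat_rank U"
  shows "\<exists>P \<in> carrier_mat r m. is_pinv U P \<and> P * U = 1\<^sub>m r"
proof -
  let ?T = "transpose_mat U"
  \<comment> \<open>The pseudoinverse is \<open>(U\<^sup>T U)\<^sup>-\<^sup>1 U\<^sup>T\<close>.\<close>
  define G where "G = ?T * U"
  have T: "?T \<in> carrier_mat r m" using U by simp
  have G: "G \<in> carrier_mat r r" using U by (simp add: G_def)
  \<comment> \<open>A kernel vector \<open>x\<close> of the Gram matrix satisfies
    \<open>(U x) . (U x) = 0\<close>, hence \<open>U x = 0\<close> over the reals, and full column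
    rank gives \<open>x = 0\<close>.\<close>
  have "det G \<noteq> 0"
  proof
    assume "det G = 0"
    then obtain x where x: "x \<in> carrier_vec r" "x \<noteq> 0\<^sub>v r" "G *\<^sub>v x = 0\<^sub>v r"
      using det_0_iff_vec_prod_zero_field[OF G] by auto
    define y where "y = U *\<^sub>v x"
    have y: "y \<in> carrier_vec m" using U x by (simp add: y_def)
    have "?T *\<^sub>v y = 0\<^sub>v r"
      using x(3) assoc_mult_mat_vec[OF T U x(1)] by (simp add: G_def y_def)
    then have "(?T *\<^sub>v y) \<bullet> x = 0" using x(1) by simp
    moreover have "(?T *\<^sub>v y) \<bullet> x = y \<bullet> (U *\<^sub>v x)"
      by (rule transpose_vec_mult_scalar[OF U x(1) y])
    ultimately have "y \<bullet> y = 0" by (simp add: y_def)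
    then have "y = 0\<^sub>v m" using conjugate_square_eq_0_vec[OF y] by simp
    then have "x = 0\<^sub>v r" using full_col_rank_kernel[OF U r x(1)] by (simp add: y_def)
    with x show False by simp
  qed
  from det_non_zero_imp_unit[OF G this, of "()"]
  obtain H where H: "H \<in> carrier_mat r r" and HG: "H * G = 1\<^sub>m r" and GH: "G * H = 1\<^sub>m r"
    by (auto simp: Units_def ring_mat_simps)
  note dims = carrier_matD[OF U] carrier_matD[OF H] carrier_matD[OF G]
  have GT: "transpose_mat G = G"
    unfolding G_def using transpose_mult[OF T U] by simp
  \<comment> \<open>The inverse of the symmetric matrix \<open>G\<close> is symmetric, which makes
    \<open>U * H * U^T\<close> symmetric as the third Penrose equation demands.\<close>
  have HT: "transpose_mat H = H"
  proof -
    have "G * transpose_mat H = 1\<^sub>m r"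
      using transpose_mult[OF H G] HG GT by simp
    then have "H * (G * transpose_mat H) = H" using H by simp
    moreover have "H * (G * transpose_mat H) = (H * G) * transpose_mat H"
      using dims by (simp add: mult_mat_assoc_dim)
    ultimately show ?thesis using HG H by simp
  qed
  let ?P = "H * ?T"
  have P: "?P \<in> carrier_mat r m" using H U by simp
  have PU: "?P * U = 1\<^sub>m r"
    using dims HG by (simp add: mult_mat_assoc_dim G_def)
  have "transpose_mat (U * ?P) = U * ?P"
    using transpose_mult[OF U P] transpose_mult[OF H T] HT dims
    by (simp add: mult_mat_assoc_dim)
  moreover have "U * ?P * U = U"
    using PU dims by (simp add: mult_mat_assoc_dim)
  moreover have "?P * U * ?P = ?P" unfolding PU using P by (rule left_mult_one_mat)
  ultimately have "is_pinv U ?P" using PU P dims by (simp add: is_pinv_def)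
  with P PU show ?thesis by blast
qed

text \<open>Transposition preserves the first two Penrose equations and exchanges the two symmetry
  conditions. This reduces full row rank to full column rank.\<close>

lemma is_pinv_transpose:
  assumes "is_pinv (transpose_mat M) P"
  shows "is_pinv M (transpose_mat P)"
proof -
  have M: "M \<in> carrier_mat (dim_row M) (dim_col M)" by simp
  then have MT: "transpose_mat M \<in> carrier_mat (dim_col M) (dim_row M)" by simp
  have P: "P \<in> carrier_mat (dim_row M) (dim_col M)"
    using assms by (simp add: is_pinv_def)
  then have PT: "transpose_mat P \<in> carrier_mat (dim_col M) (dim_row M)" by simp
  have 1: "transpose_mat M * P = transpose_mat (transpose_mat P * M)"
    using transpose_mult[OF PT M] by simp
  have 2: "P * transpose_mat M = transpose_mat (M * transpose_mat P)"
    using transpose_mult[OF M PT] by simp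
  have 3: "transpose_mat M * P * transpose_mat M = transpose_mat (M * transpose_mat P * M)"
    using transpose_mult[OF mult_carrier_mat[OF M PT] M] 2 carrier_matD[OF P]
    by (simp add: mult_mat_assoc_dim)
  have 4: "P * transpose_mat M * P = transpose_mat (transpose_mat P * M * transpose_mat P)"
    using transpose_mult[OF mult_carrier_mat[OF PT M] PT] 1 carrier_matD[OF P]
    by (simp add: mult_mat_assoc_dim)
  note eqs = assms[unfolded is_pinv_def 3 4, unfolded 1 2 transpose_transpose]
  have "M * transpose_mat P * M = M"
    using eqs arg_cong[of _ _ transpose_mat] by (metis transpose_transpose)
  moreover have "transpose_mat P * M * transpose_mat P = transpose_mat P"
    using eqs by (metis transpose_transpose)
  ultimately show ?thesis using eqs PT by (simp add: is_pinv_def)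
qed

lemma pinv_full_col_rank:
  assumes U: "U \<in> carrier_mat m r" and r: "r \<le> mat_rank U"
  shows "pinv U \<in> carrier_mat r m" "pinv U * U = 1\<^sub>m r"
proof -
  from pinv_full_col_rank_exists[OF assms]
  obtain P where P: "P \<in> carrier_mat r m" "is_pinv U P" "P * U = 1\<^sub>m r" by blast
  then show "pinv U \<in> carrier_mat r m" "pinv U * U = 1\<^sub>m r"
    using pinv_eqI[OF P(2)] by simp_all
qed

lemma pinv_full_row_rank:
  assumes V: "V \<in> carrier_mat r n" and r: "r \<le> mat_rank V"
  shows "pinv V \<in> carrier_mat n r" "V * pinv V = 1\<^sub>m r"
proof -
  have VT: "transpose_mat V \<in> carrier_mat n r" using V by simp
  have "r \<le> mat_rank (transpose_mat V)" using r by (simp add: mat_rank_transpose)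
  from pinv_full_col_rank_exists[OF VT this]
  obtain P where P: "P \<in> carrier_mat r n" "is_pinv (transpose_mat V) P"
    "P * transpose_mat V = 1\<^sub>m r" by blast
  have e: "pinv V = transpose_mat P" by (rule pinv_eqI[OF is_pinv_transpose[OF P(2)]])
  show "pinv V \<in> carrier_mat n r" using e P by simp
  have "V * transpose_mat P = transpose_mat (P * transpose_mat V)"
    using transpose_mult[OF P(1) VT] by simp
  then show "V * pinv V = 1\<^sub>m r" using e P(3) by simp
qed

text \<open>The rank of a product is at most that of each factor. Since the product attains the
  inner dimension \<open>r\<close>, both factors have full rank and their pseudoinverses are
  one-sided inverses.\<close>

lemma pinv_rank_factors:
  assumes B: "B \<in> carrier_mat m r" and C: "C \<in> carrier_mat r n" and r: "mat_rank (B * C) = r"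
  shows "pinv B \<in> carrier_mat r m" "pinv B * B = 1\<^sub>m r"
    "pinv C \<in> carrier_mat n r" "C * pinv C = 1\<^sub>m r"
proof -
  have "low_rank (B * C) (mat_rank B)"
    by (rule low_rank_mult_right[where q = n]) (use B C in \<open>auto simp: mat_rank_le_iff[symmetric]\<close>)
  then have "r \<le> mat_rank B" using r by (simp add: mat_rank_le_iff[symmetric])
  from pinv_full_col_rank[OF B this] show "pinv B \<in> carrier_mat r m" "pinv B * B = 1\<^sub>m r" .
  have "low_rank (B * C) (mat_rank C)"
    by (rule low_rank_mult_left[where p = m]) (use B C in \<open>auto simp: mat_rank_le_iff[symmetric]\<close>)
  then have "r \<le> mat_rank C" using r by (simp add: mat_rank_le_iff[symmetric])
  from pinv_full_row_rank[OF C this] show "pinv C \<in> carrier_mat n r" "C * pinv C = 1\<^sub>m r" .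
qed

text \<open>In a rank factorization \<open>D = U V\<close>, the product of the pseudoinverses in
  reverse order works, as \<open>V\<close> cancels on the right and \<open>U\<close> on the
  left.\<close>

lemma generalized_inverse_exists:
  fixes D :: "real mat"
  assumes "D \<in> carrier_mat m n"
  obtains H where "H \<in> carrier_mat n m" "D * H * D = D"
proof -
  obtain U V where U: "U \<in> carrier_mat m (mat_rank D)" and V: "V \<in> carrier_mat (mat_rank D) n"
    and D: "D = U * V" 
    by (rule rank_factorization[of D, unfolded carrier_matD[OF assms]])
  note p = pinv_rank_factors[OF U V, folded D, OF refl]
  have "D * (pinv V * pinv U) * D = U * ((V * pinv V) * ((pinv U * U) * V))"
    unfolding D using carrier_matD[OF U] carrier_matD[OF V] carrier_matD[OF p(1)] carrier_matD[OF p(3)]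
    by (simp add: mult_mat_assoc_dim)
  also have "\<dots> = D" unfolding p(2) p(4) using U V D by simp
  finally show thesis using that[of "pinv V * pinv U"] p(1,3) by simp
qed

text \<open>\<open>b * a\<close> is idempotent because \<open>a * b = 1\<close>; the matrix in
  question is the projection onto the kernel of \<open>a\<close> along the range of
  \<open>b\<close>. Its trace is \<open>k + s\<close> minus the trace of
  \<open>a * b\<close>.\<close>

lemma complement_rank:
  assumes a: "a \<in> carrier_mat k (k + s)" and b: "b \<in> carrier_mat (k + s) k" and ab: "a * b = 1\<^sub>m k"
  shows "mat_rank (1\<^sub>m (k + s) - b * a) = s"
proof -
  define N where "N = k + s"
  define E where "E = 1\<^sub>m N - b * a"
  note dab = carrier_matD[OF a[folded N_def]] carrier_matD[OF b[folded N_def]]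
  have E: "E \<in> carrier_mat N N" unfolding E_def using dab by auto
  define P where "P = b * a"
  have P: "P \<in> carrier_mat N N" by (rule carrier_matI) (simp_all add: P_def dab)
  have "P * P = b * ((a * b) * a)" using dab by (simp add: mult_mat_assoc_dim P_def)
  then have PP: "P * P = P" using ab a by (simp add: P_def)
  have "E * E = (1\<^sub>m N - P) - (P - P * P)"
    unfolding E_def P_def[symmetric] using carrier_matD[OF P]
    by (simp add: minus_mult_distrib_dim mult_minus_distrib_dim one_mult_dim mult_one_dim)
  then have EE: "E * E = E"
    unfolding E_def P_def[symmetric] PP using P by (intro eq_matI) auto
  define q where "q = mat_rank E"
  obtain Y Z where Y: "Y \<in> carrier_mat N q" and Z: "Z \<in> carrier_mat q N" and YZ: "E = Y * Z"
    unfolding q_def by (rule rank_factorization[of E, unfolded carrier_matD[OF E]])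
  note p = pinv_rank_factors[OF Y Z, folded YZ, OF q_def[symmetric]]
  note dims = carrier_matD[OF Y] carrier_matD[OF Z] carrier_matD[OF p(1)] carrier_matD[OF p(3)]
  \<comment> \<open>\<open>Y (Z Y) Z = E E = E = Y Z\<close>, and the one-sided inverses of
    \<open>Y\<close> and \<open>Z\<close> cancel the outer factors.\<close>
  have "Z * Y = (pinv Y * Y) * (Z * Y) * (Z * pinv Z)" unfolding p(2,4) using dims by simp
  also have "\<dots> = pinv Y * (E * E) * pinv Z"
    unfolding YZ using dims by (simp add: mult_mat_assoc_dim)
  also have "\<dots> = (pinv Y * Y) * (Z * pinv Z)"
    unfolding EE unfolding YZ using dims by (simp add: mult_mat_assoc_dim)
  also have "\<dots> = 1\<^sub>m q" unfolding p(2,4) by simp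
  finally have ZY: "Z * Y = 1\<^sub>m q" .
  \<comment> \<open>\<open>E\<close> is idempotent, so its rank is its trace.\<close>
  have trace: "(\<Sum>i<u. (P * Q) $$ (i, i)) = (\<Sum>i<v. (Q * P) $$ (i, i))"
    if "P \<in> carrier_mat u v" "Q \<in> carrier_mat v u" for P Q :: "real mat" and u v
  proof -
    have "(\<Sum>i<u. (P * Q) $$ (i, i)) = (\<Sum>i<u. \<Sum>j<v. P $$ (i, j) * Q $$ (j, i))"
      using that by (intro sum.cong) (auto simp: scalar_prod_def atLeast0LessThan)
    also have "\<dots> = (\<Sum>j<v. \<Sum>i<u. P $$ (i, j) * Q $$ (j, i))" by (rule sum.swap)
    also have "\<dots> = (\<Sum>i<v. (Q * P) $$ (i, i))"
      using that by (intro sum.cong) (auto simp: scalar_prod_def atLeast0LessThan mult.commute)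
    finally show ?thesis .
  qed
  have "real q = (\<Sum>i<N. E $$ (i, i))" using trace[OF Z Y] ZY YZ by simp
  also have "\<dots> = (\<Sum>i<N. 1 - (b * a) $$ (i, i))"
    unfolding E_def using dab by (intro sum.cong) auto
  also have "\<dots> = real N - (\<Sum>i<k. (a * b) $$ (i, i))"
    using trace[OF b a] by (simp add: sum_subtractf N_def)
  also have "\<dots> = real s" unfolding ab by (simp add: N_def)
  finally show ?thesis by (simp add: q_def E_def N_def)
qed


section \<open>The tangent cone of a single rank condition\<close>

lemma det_tendsto:
  assumes K: "\<And>l. K l \<in> carrier_mat n n" and N: "N \<in> carrier_mat n n"
    and lim: "\<And>i j. i < n \<Longrightarrow> j < n \<Longrightarrow> (\<lambda>l. K l $$ (i, j)) \<longlonglongrightarrow> (N $$ (i, j) :: real)"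
  shows "(\<lambda>l. det (K l)) \<longlonglongrightarrow> det N"
  unfolding det_def'[OF K] det_def'[OF N]
  by (intro tendsto_sum tendsto_mult tendsto_const tendsto_prod lim)
     (auto dest: permutes_in_image)

text \<open>The minors of size \<open>r + 1\<close> are continuous in the entries and vanish along
  the sequence, hence also at the limit.\<close>

lemma mat_rank_le_closed:
  assumes K: "\<And>l. K l \<in> carrier_mat m n" and N: "N \<in> carrier_mat m n"
    and lim: "\<And>i j. i < m \<Longrightarrow> j < n \<Longrightarrow> (\<lambda>l. K l $$ (i, j)) \<longlonglongrightarrow> N $$ (i, j)"
    and r: "\<And>l. mat_rank (K l) \<le> r"
  shows "mat_rank N \<le> r"
  unfolding mat_rank_le_iff_minors
proof (intro allI impI)
  fix I J assume IJ: "I \<subseteq> {..<dim_row N} \<and> card I = r + 1 \<and> J \<subseteq> {..<dim_col N} \<and> card J = r + 1"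
  then have eqs: "{i. i < m \<and> i \<in> I} = I" "{j. j < n \<and> j \<in> J} = J" using N by auto
  have sub: "submatrix M I J \<in> carrier_mat (r + 1) (r + 1)" if "M \<in> carrier_mat m n" for M :: "real mat"
    by (rule carrier_matI)
      (simp_all only: dim_submatrix carrier_matD[OF that] eqs IJ)
  have ent: "submatrix M I J $$ (i, j) = M $$ (pick I i, pick J j)"
    if "M \<in> carrier_mat m n" "i < r + 1" "j < r + 1" for M :: "real mat" and i j
    by (rule submatrix_index) (simp_all only: carrier_matD[OF that(1)] eqs IJ that)
  have "(\<lambda>l. det (submatrix (K l) I J)) \<longlonglongrightarrow> det (submatrix N I J)"
  proof (rule det_tendsto[OF sub[OF K] sub[OF N]])
    fix i j assume ij: "i < r + 1" "j < r + 1"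
    then have "pick I i \<in> I" "pick J j \<in> J" using IJ by (auto intro: pick_in_set_le)
    then have "pick I i < m" "pick J j < n" using IJ N by auto
    then show "(\<lambda>l. submatrix (K l) I J $$ (i, j)) \<longlonglongrightarrow> submatrix N I J $$ (i, j)"
      using lim ij by (simp add: ent[OF K] ent[OF N])
  qed
  moreover have "det (submatrix (K l) I J) = 0" for l
    using r[of l] IJ carrier_matD[OF K[of l]] carrier_matD[OF N]
    unfolding mat_rank_le_iff_minors by simp
  ultimately show "det (submatrix N I J) = 0" by (simp add: LIMSEQ_const_iff)
qed

lemma mult_mat_tendsto:
  assumes P: "P \<in> carrier_mat p m" and K: "\<And>l. K l \<in> carrier_mat m n" and N: "N \<in> carrier_mat m n"
    and lim: "\<And>i j. i < m \<Longrightarrow> j < n \<Longrightarrow> (\<lambda>l. K l $$ (i, j)) \<longlonglongrightarrow> (N $$ (i, j) :: real)"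
    and ij: "i < p" "j < n"
  shows "(\<lambda>l. (P * K l) $$ (i, j)) \<longlonglongrightarrow> (P * N) $$ (i, j)"
proof -
  have ent: "(P * M) $$ (i, j) = (\<Sum>q<m. P $$ (i, q) * M $$ (q, j))"
    if "M \<in> carrier_mat m n" for M
    using that P ij by (simp add: scalar_prod_def atLeast0LessThan)
  show ?thesis
    unfolding ent[OF K] ent[OF N]
    by (intro tendsto_sum tendsto_mult tendsto_const lim) (use ij in auto)
qed

lemma zero_mult_dim: "dim_row A = q \<Longrightarrow> 0\<^sub>m p q * A = (0\<^sub>m p (dim_col A) :: real mat)"
  by (auto simp: left_mult_zero_mat[of A q "dim_col A"])

lemma mult_zero_dim: "dim_col A = p \<Longrightarrow> A * 0\<^sub>m p q = (0\<^sub>m (dim_row A) q :: real mat)"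
  by (auto simp: right_mult_zero_mat[of A "dim_row A" p])

lemma smult_mult_dim: "dim_col A = dim_row B \<Longrightarrow> (c \<cdot>\<^sub>m A) * B = c \<cdot>\<^sub>m (A * B :: real mat)"
  by (rule mult_smult_assoc_mat[of A "dim_row A" "dim_row B" B "dim_col B"]) auto

lemma mult_smult_dim: "dim_col A = dim_row B \<Longrightarrow> A * (c \<cdot>\<^sub>m B) = c \<cdot>\<^sub>m (A * B :: real mat)"
  by (rule mult_smult_distrib[of A "dim_row A" "dim_row B" B "dim_col B"]) auto

lemma zero_add_dim: "dim_row A = p \<Longrightarrow> dim_col A = q \<Longrightarrow> 0\<^sub>m p q + A = (A :: real mat)"
  by (intro eq_matI) auto

lemmas mat_alg = mat_dim_simps zero_mult_dim mult_zero_dim smult_mult_dim mult_smult_dim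

section \<open>Projections attached to a factorization of one matricization\<close>

locale rank_factors =
  fixes m n k :: nat and B C :: "real mat"
  assumes B: "B \<in> carrier_mat m k" and C: "C \<in> carrier_mat k n"
    and rank: "mat_rank (B * C) = k"
begin

definition "b = pinv B"
definition "c = pinv C"
definition "L = 1\<^sub>m m - B * b"
definition "R = 1\<^sub>m n - c * C"

lemma carriers: "b \<in> carrier_mat k m" "c \<in> carrier_mat n k"
  "L \<in> carrier_mat m m" "R \<in> carrier_mat n n" "B * C \<in> carrier_mat m n"
proof -
  show "b \<in> carrier_mat k m" "c \<in> carrier_mat n k"
    using pinv_rank_factors[OF B C rank] by (simp_all add: b_def c_def)
  then show "L \<in> carrier_mat m m" "R \<in> carrier_mat n n" "B * C \<in> carrier_mat m n"
    using B C by (auto simp: L_def R_def)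
qed

lemmas dims = carriers[THEN carrier_matD(1)] carriers[THEN carrier_matD(2)]
  carrier_matD[OF B] carrier_matD[OF C]

text \<open>From these identities it follows that \<open>L\<close> is a projection with
  \<open>L B = 0\<close> and \<open>b L = 0\<close>, and that \<open>C R = 0\<close>.\<close>

lemma bB: "b * B = 1\<^sub>m k" and Cc: "C * c = 1\<^sub>m k"
  using pinv_rank_factors[OF B C rank] by (simp_all add: b_def c_def)

lemma LB: "L * B = 0\<^sub>m m k"
  unfolding L_def using dims B by (simp add: mat_alg bB)

lemma bL: "b * L = 0\<^sub>m k m"
proof -
  have "b * (B * b) = (b * B) * b" using dims by (simp add: mult_mat_assoc_dim)
  then have "b * (B * b) = b" using carriers by (simp add: bB)
  then show ?thesis unfolding L_def using dims carriers by (simp add: mat_alg)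
qed

lemma CR: "C * R = 0\<^sub>m k n"
proof -
  have "C * (c * C) = (C * c) * C" using dims by (simp add: mult_mat_assoc_dim)
  then have "C * (c * C) = C" using C by (simp add: Cc)
  then show ?thesis unfolding R_def using dims C by (simp add: mat_alg)
qed

lemma bBC: "b * (B * C) = C"
proof -
  have "b * (B * C) = (b * B) * C" using dims by (simp add: mult_mat_assoc_dim)
  then show ?thesis using C by (simp add: bB)
qed

lemma LBC: "L * (B * C) = 0\<^sub>m m n"
proof -
  have "L * (B * C) = (L * B) * C" using dims by (simp add: mult_mat_assoc_dim)
  then show ?thesis using dims by (simp add: LB zero_mult_dim)
qed

lemma LL: "L * L = L"
proof -
  have "L * L = L - B * (b * L)"
    by (subst (1) L_def) (use dims in \<open>simp add: mat_alg\<close>)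
  then show ?thesis using dims carriers by (simp add: bL mat_alg) (auto intro!: eq_matI)
qed

text \<open>The bound \<open>k + s\<close> passes to the limit matrix \<open>N = A + L X\<close>. Of
  this budget, \<open>k\<close> is spent on \<open>b N = C\<close>, which has full row rank, so that
  \<open>s\<close> is left for the part seen between \<open>L\<close> and \<open>R\<close>.\<close>

lemma rank_le_if_tangent:
  assumes M: "\<And>l. M l \<in> carrier_mat m n" and X: "X \<in> carrier_mat m n"
    and r: "\<And>l. mat_rank (M l) \<le> k + s"
    and limM: "\<And>i j. i < m \<Longrightarrow> j < n \<Longrightarrow> (\<lambda>l. M l $$ (i, j)) \<longlonglongrightarrow> (B * C) $$ (i, j)"
    and limX: "\<And>i j. i < m \<Longrightarrow> j < n \<Longrightarrow>
      (\<lambda>l. a l * (M l $$ (i, j) - (B * C) $$ (i, j))) \<longlonglongrightarrow> X $$ (i, j)"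
  shows "mat_rank (L * X * R) \<le> s"
proof -
  define A where "A = B * C"
  have A: "A \<in> carrier_mat m n" using carriers by (simp add: A_def)
  have LA: "L * A = 0\<^sub>m m n" unfolding A_def by (rule LBC)
  have bA: "b * A = C" unfolding A_def by (rule bBC)
  have Bb: "B * b \<in> carrier_mat m m" using B carriers by simp
  define N where "N = A + L * X"
  have N: "N \<in> carrier_mat m n" using A X carriers by (simp add: N_def)
  define D where "D l = a l \<cdot>\<^sub>m (M l - A)" for l
  have D: "D l \<in> carrier_mat m n" for l using carrier_matD[OF M[of l]] carrier_matD[OF A]
    by (intro carrier_matI) (simp_all add: D_def)
  \<comment> \<open>\<open>K l = (B b + a\<^sub>l L) M\<^sub>l\<close> blows up the component of \<open>M\<^sub>l\<close> outside the column space of \<open>B\<close>, so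
    that its limit \<open>N\<close> sees \<open>X\<close>; bounded rank passes to the limit.\<close>
  define K where "K l = (B * b) * M l + L * D l" for l
  have K: "K l \<in> carrier_mat m n" for l
    using carrier_matD[OF D[of l]] dims by (intro carrier_matI) (simp_all add: K_def)
  have rK: "mat_rank (K l) \<le> k + s" for l
  proof -
    note dl = dims carrier_matD[OF M[of l]] carrier_matD[OF A]
    \<comment> \<open>With \<open>D l\<close> the limit of \<open>K l\<close> can be read off; as a
      left multiple of \<open>M l\<close> it inherits the rank bound. \<open>L * A = 0\<close>
      identifies the two forms.\<close>
    have "L * D l = a l \<cdot>\<^sub>m (L * M l)"
      unfolding D_def using dl by (simp add: mult_smult_dim mult_minus_distrib_dim LA) (auto intro!: eq_matI)
    then have "K l = (B * b + a l \<cdot>\<^sub>m L) * M l"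
      unfolding K_def using dl by (simp add: add_mult_distrib_dim smult_mult_dim)
    moreover have "low_rank (M l) (k + s)" using r by (simp add: mat_rank_le_iff)
    ultimately show ?thesis
      unfolding mat_rank_le_iff using dl by (auto intro!: low_rank_mult_left[where p = m] carrier_matI)
  qed
  have "mat_rank N \<le> k + s"
  proof (rule mat_rank_le_closed[OF K N _ rK])
    fix i j assume ij: "i < m" "j < n"
    have 1: "(\<lambda>l. ((B * b) * M l) $$ (i, j)) \<longlonglongrightarrow> ((B * b) * A) $$ (i, j)"
      by (rule mult_mat_tendsto[OF Bb M A _ ij]) (use limM in \<open>simp add: A_def\<close>)
    have "(B * b) * A = A"
      using dims carrier_matD[OF A] by (simp add: mult_mat_assoc_dim bA) (simp add: A_def)
    moreover have "(\<lambda>l. (L * D l) $$ (i, j)) \<longlonglongrightarrow> (L * X) $$ (i, j)"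
    proof (rule mult_mat_tendsto[OF carriers(3) D X _ ij])
      fix i j assume ij: "i < m" "j < n"
      have "D l $$ (i, j) = a l * (M l $$ (i, j) - (B * C) $$ (i, j))" for l
        using carrier_matD[OF M[of l]] carrier_matD[OF A] ij
        by (simp add: D_def A_def del: index_mult_mat(1))
      then show "(\<lambda>l. D l $$ (i, j)) \<longlonglongrightarrow> X $$ (i, j)" using limX[OF ij] by simp
    qed
    ultimately have "(\<lambda>l. ((B * b) * M l) $$ (i, j) + (L * D l) $$ (i, j)) \<longlonglongrightarrow> A $$ (i, j) + (L * X) $$ (i, j)"
      using 1 by (intro tendsto_add) (simp_all del: index_mult_mat(1))
    moreover have "K l $$ (i, j) = ((B * b) * M l) $$ (i, j) + (L * D l) $$ (i, j)" for l
      unfolding K_def by (rule index_add_mat) (use ij dims carrier_matD[OF D[of l]] in auto)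
    moreover have "N $$ (i, j) = A $$ (i, j) + (L * X) $$ (i, j)"
      unfolding N_def by (rule index_add_mat) (use ij dims carrier_matD[OF X] in auto)
    ultimately show "(\<lambda>l. K l $$ (i, j)) \<longlonglongrightarrow> N $$ (i, j)" by simp
  qed
  then have "low_rank N (k + s)" by (simp add: mat_rank_le_iff)
  then obtain U V where U: "U \<in> carrier_mat m (k + s)" and V: "V \<in> carrier_mat (k + s) n"
    and UV: "N = U * V" unfolding low_rank_def carrier_matD[OF N] by blast
  note ds = dims carrier_matD[OF U] carrier_matD[OF V] carrier_matD[OF X] carrier_matD[OF A]
  have bN: "b * N = C"
  proof -
    have "b * (L * X) = (b * L) * X" using ds by (simp add: mult_mat_assoc_dim)
    also have "\<dots> = 0\<^sub>m k n" unfolding bL using ds by (simp add: zero_mult_dim)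
    finally show ?thesis unfolding N_def using ds C by (simp add: mult_add_distrib_dim bA)
  qed
  have LN: "L * N = L * X"
  proof -
    have "L * (L * X) = L * X" using ds LL mult_mat_assoc_dim[of L L X] by simp
    moreover have "L * X \<in> carrier_mat m n" using X carriers by simp
    ultimately show ?thesis unfolding N_def using ds by (simp add: mult_add_distrib_dim LA)
  qed
  \<comment> \<open>\<open>b N = C\<close> becomes \<open>\<alpha> V = C\<close>. As
    \<open>c\<close> is a right inverse of \<open>C\<close>, \<open>\<beta>\<close> is one of
    \<open>\<alpha>\<close>, so the kernel of \<open>\<alpha>\<close> has dimension
    \<open>s\<close>.\<close>
  define \<alpha> \<beta> where "\<alpha> = b * U" and "\<beta> = V * c"
  have \<alpha>: "\<alpha> \<in> carrier_mat k (k + s)" and \<beta>: "\<beta> \<in> carrier_mat (k + s) k"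
    using U V carriers by (auto simp: \<alpha>_def \<beta>_def)
  note ds = ds carrier_matD[OF \<alpha>] carrier_matD[OF \<beta>]
  have \<alpha>V: "\<alpha> * V = C"
    using bN ds by (simp add: \<alpha>_def UV mult_mat_assoc_dim)
  have \<alpha>\<beta>: "\<alpha> * \<beta> = 1\<^sub>m k"
  proof -
    have "\<alpha> * \<beta> = (\<alpha> * V) * c" unfolding \<beta>_def using ds by (simp add: mult_mat_assoc_dim)
    then show ?thesis by (simp add: \<alpha>V Cc)
  qed
  \<comment> \<open>\<open>E\<close> projects onto the kernel of \<open>\<alpha>\<close>, which has dimension \<open>s\<close> and contains the columns of \<open>V R\<close>.\<close>
  define E where "E = 1\<^sub>m (k + s) - \<beta> * \<alpha>"
  have E: "E \<in> carrier_mat (k + s) (k + s)" unfolding E_def by (rule carrier_matI) (use ds in auto)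
  have rE: "low_rank E s"
    using complement_rank[OF \<alpha> \<beta> \<alpha>\<beta>] by (simp add: E_def mat_rank_le_iff[symmetric])
  have EVR: "E * (V * R) = V * R"
  proof -
    have "\<alpha> * (V * R) = 0\<^sub>m k n"
      using mult_mat_assoc_dim[of \<alpha> V R] ds by (simp add: \<alpha>V CR)
    then have "E * (V * R) = V * R - 0\<^sub>m (k + s) n"
      unfolding E_def using ds by (simp add: mat_alg)
    then show ?thesis using ds by (auto intro!: eq_matI)
  qed
  have "L * X * R = L * N * R" by (simp add: LN)
  also have "\<dots> = (L * U) * (E * (V * R))"
    unfolding EVR UV using ds by (simp add: mult_mat_assoc_dim)
  finally have "L * X * R = (L * U) * (E * (V * R))" .
  moreover have "low_rank ((L * U) * (E * (V * R))) s"
    by (intro low_rank_mult_left[where p = m] low_rank_mult_right[where q = n] rE carrier_matI)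
      (use ds carrier_matD[OF E] in auto)
  ultimately show ?thesis by (simp add: mat_rank_le_iff)
qed

text \<open>\<open>P0\<close> is the projection onto the span of the columns of \<open>B\<close> and
  \<open>D\<close>, of dimension at most \<open>k + s\<close>. It fixes \<open>A\<close> and
  \<open>X R\<close>, so the defect \<open>X - P0 X\<close> is a multiple of \<open>C\<close> from
  the left and \<open>P1\<close> can correct it.\<close>

lemma low_rank_pencil:
  assumes X: "X \<in> carrier_mat m n" and r: "mat_rank (L * X * R) \<le> s"
  obtains P0 P1 Z where "P0 \<in> carrier_mat m m" "P1 \<in> carrier_mat m m" "Z \<in> carrier_mat m n"
    "\<And>t. mat_rank (P0 + t \<cdot>\<^sub>m P1) \<le> k + s"
    "\<And>t. (P0 + t \<cdot>\<^sub>m P1) * (B * C + t \<cdot>\<^sub>m X) = B * C + t \<cdot>\<^sub>m X + t\<^sup>2 \<cdot>\<^sub>m Z"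
proof -
  define A where "A = B * C"
  have A: "A \<in> carrier_mat m n" using carriers by (simp add: A_def)
  define D where "D = L * X * R"
  have D: "D \<in> carrier_mat m n" using X carriers by (simp add: D_def)
  obtain H where H: "H \<in> carrier_mat n m" and DHD: "D * H * D = D"
    by (rule generalized_inverse_exists[OF D])
  \<comment> \<open>\<open>F\<close> annihilates \<open>A\<close> because \<open>L A = 0\<close>,
    and it maps \<open>X R\<close> to \<open>D H D = D = L X R\<close>. Together with
    \<open>B b = 1 - L\<close> this fixes \<open>X R\<close>.\<close>
  define F where "F = D * H * L"
  have F: "F \<in> carrier_mat m m" using D H carriers by (simp add: F_def)
  define P0 where "P0 = B * b + F"
  have P0: "P0 \<in> carrier_mat m m" using B carriers F by (simp add: P0_def)
  \<comment> \<open>\<open>P1\<close> solves the first-order condition \<open>P0 X + P1 A = X\<close>; moreover \<open>P1 P0 = P1\<close>, so that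
    \<open>P0 + t P1 = (1 + t P1) P0\<close>.\<close>
  define P1 where "P1 = (X - P0 * X) * (c * b)"
  have P1: "P1 \<in> carrier_mat m m" 
    using carrier_matD[OF X] carrier_matD[OF P0] dims by (intro carrier_matI) (simp_all add: P1_def)
  note ds = dims carrier_matD[OF X] carrier_matD[OF A] carrier_matD[OF D] carrier_matD[OF H]
    carrier_matD[OF F] carrier_matD[OF P0] carrier_matD[OF P1]
  have bA: "b * A = C" unfolding A_def by (rule bBC)
  have LA: "L * A = 0\<^sub>m m n" unfolding A_def by (rule LBC)
  have P0A: "P0 * A = A"
  proof -
    have "P0 * A = B * (b * A) + D * (H * (L * A))"
      unfolding P0_def F_def using ds by (simp add: mat_alg)
    also have "\<dots> = A + 0\<^sub>m m n" unfolding bA LA using ds by (simp add: mult_zero_dim A_def)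
    finally show ?thesis using A by simp
  qed
  have P0XR: "P0 * (X * R) = X * R"
  proof -
    have "P0 * (X * R) = B * (b * (X * R)) + D * (H * (L * (X * R)))"
      unfolding P0_def F_def using ds by (simp add: mat_alg)
    also have "D * (H * (L * (X * R))) = L * (X * R)"
      using DHD ds by (simp add: D_def mult_mat_assoc_dim)
    also have "L * (X * R) = X * R - B * (b * (X * R))"
      by (subst L_def) (use ds in \<open>simp add: mat_alg\<close>)
    finally show ?thesis using ds by (auto intro!: eq_matI simp del: index_mult_mat(1))
  qed
  define G where "G = X - P0 * X"
  have G: "G \<in> carrier_mat m n" using ds by (intro carrier_matI) (simp_all add: G_def)
  note ds = ds carrier_matD[OF G]
  have GR: "G * R = 0\<^sub>m m n"
    unfolding G_def using ds P0XR
    by (simp add: mat_alg) (auto intro!: eq_matI simp del: index_mult_mat(1))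
  have P1A: "P1 * A = G"
  proof -
    \<comment> \<open>\<open>G R = 0\<close> leaves \<open>G = G c C\<close>, and
      \<open>C = b A\<close>. Hence \<open>G = (G c b) A\<close>, which explains the factor
      \<open>c * b\<close> in \<open>P1\<close>.\<close>
    have "R + c * C = 1\<^sub>m n"
      unfolding R_def using dims by (intro eq_matI) (simp_all del: index_mult_mat(1))
    then have "G = G * (R + c * C)" using G by simp
    also have "\<dots> = G * (c * C)" using ds by (simp add: mult_add_distrib_dim GR zero_add_dim)
    also have "\<dots> = P1 * A"
      unfolding P1_def G_def[symmetric] using ds by (simp add: mult_mat_assoc_dim bA)
    finally show ?thesis by simp
  qed
  have P1P0: "P1 * P0 = P1"
  proof -
    have "b * D = 0\<^sub>m k n"
      using bL mult_mat_assoc_dim[of b L "X * R"] ds by (simp add: D_def mult_mat_assoc_dim zero_mult_dim)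
    then have bF: "b * F = 0\<^sub>m k m"
      using mult_mat_assoc_dim[of b D "H * L"] ds by (simp add: F_def mult_mat_assoc_dim zero_mult_dim)
    have "b * (B * b) = b"
      using mult_mat_assoc_dim[of b B b] bB ds carriers by simp
    then have "b * P0 = b" unfolding P0_def using ds carriers bF by (simp add: mult_add_distrib_dim)
    then show ?thesis unfolding P1_def using ds by (simp add: mult_mat_assoc_dim)
  qed
  have rP0: "low_rank P0 (k + s)"
  proof -
    have "low_rank D s" using r by (simp add: D_def mat_rank_le_iff)
    then have "low_rank F s"
      unfolding F_def by (intro low_rank_mult_right[where q = m] carrier_matI) (use ds in auto)
    then show ?thesis
      unfolding P0_def using ds by (intro low_rank_add low_rankI[OF B carriers(1)]) auto
  qed
  define Z where "Z = P1 * X"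
  have Z: "Z \<in> carrier_mat m n" using P1 X by (simp add: Z_def)
  show thesis
  proof (rule that[OF P0 P1 Z])
    fix t
    have "P0 + t \<cdot>\<^sub>m P1 = (1\<^sub>m m + t \<cdot>\<^sub>m P1) * P0"
      using ds by (simp add: mat_alg P1P0)
    moreover have "low_rank ((1\<^sub>m m + t \<cdot>\<^sub>m P1) * P0) (k + s)"
      by (rule low_rank_mult_left[OF rP0, where p = m], rule carrier_matI) (simp_all add: ds)
    ultimately show "mat_rank (P0 + t \<cdot>\<^sub>m P1) \<le> k + s" by (simp only: mat_rank_le_iff)
    have "(P0 + t \<cdot>\<^sub>m P1) * (A + t \<cdot>\<^sub>m X) = (P0 * A + t \<cdot>\<^sub>m (P1 * A)) + (t \<cdot>\<^sub>m (P0 * X) + t \<cdot>\<^sub>m (t \<cdot>\<^sub>m Z))"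
      using ds by (simp add: mat_alg Z_def)
        (auto intro!: eq_matI simp: algebra_simps simp del: index_mult_mat(1))
    also have "\<dots> = A + t \<cdot>\<^sub>m X + t\<^sup>2 \<cdot>\<^sub>m Z"
      unfolding P0A P1A G_def using ds carrier_matD[OF Z]
      by (intro eq_matI) (auto simp: algebra_simps power2_eq_square simp del: index_mult_mat(1))
    finally show "(P0 + t \<cdot>\<^sub>m P1) * (B * C + t \<cdot>\<^sub>m X) = B * C + t \<cdot>\<^sub>m X + t\<^sup>2 \<cdot>\<^sub>m Z"
      by (simp add: A_def)
  qed
qed

end


section \<open>Matricizations\<close>

lemma set_multi_indices: "set (multi_indices ns) = {js. list_all2 (<) js ns}"
  by (auto simp: multi_indices_def product_lists_set list_all2_map2)

lemma distinct_multi_indices: "distinct (multi_indices ns)"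
  unfolding multi_indices_def by (intro distinct_product_lists) auto

lemma length_multi_indices: "length (multi_indices ns) = prod_list ns"
  unfolding multi_indices_def
  by (induction ns) (simp_all add: length_concat comp_def sum_list_triv)

lemma append_multi_indices:
  assumes "u \<in> set (multi_indices (take i ns))" "v \<in> set (multi_indices (drop i ns))"
  shows "u @ v \<in> set (multi_indices ns)"
  using assms list_all2_appendI[of "(<)" u "take i ns" v "drop i ns"]
  by (simp add: set_multi_indices)

lemma take_multi_indices: "js \<in> set (multi_indices ns) \<Longrightarrow> take i js \<in> set (multi_indices (take i ns))"
  and drop_multi_indices: "js \<in> set (multi_indices ns) \<Longrightarrow> drop i js \<in> set (multi_indices (drop i ns))"
  by (simp_all add: set_multi_indices list_all2_takeI list_all2_dropI)

lemma length_in_multi_indices: "js \<in> set (multi_indices ns) \<Longrightarrow> length js = length ns"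
  by (auto simp: set_multi_indices dest: list_all2_lengthD)

definition multi_index_pos :: "nat list \<Rightarrow> nat list \<Rightarrow> nat" where
  "multi_index_pos ns = the_inv_into {..<prod_list ns} ((!) (multi_indices ns))"

lemma inj_on_multi_indices: "inj_on ((!) (multi_indices ns)) {..<prod_list ns}"
  using inj_on_nth[OF distinct_multi_indices, of "{..<prod_list ns}" ns]
  by (auto simp: length_multi_indices)

lemma multi_index_pos_nth:
  "p < prod_list ns \<Longrightarrow> multi_index_pos ns (multi_indices ns ! p) = p"
  unfolding multi_index_pos_def by (rule the_inv_into_f_f[OF inj_on_multi_indices]) simp

lemma multi_index_pos_less:
  assumes "js \<in> set (multi_indices ns)"
  shows "multi_index_pos ns js < prod_list ns"
    and "multi_indices ns ! multi_index_pos ns js = js"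
proof -
  obtain p where p: "p < prod_list ns" "js = multi_indices ns ! p"
    using assms by (metis in_set_conv_nth length_multi_indices)
  then show "multi_index_pos ns js < prod_list ns"
    "multi_indices ns ! multi_index_pos ns js = js" by (simp_all add: multi_index_pos_nth)
qed

lemma nth_multi_indices: "p < prod_list ns \<Longrightarrow> multi_indices ns ! p \<in> set (multi_indices ns)"
  by (simp add: length_multi_indices)

lemma matricization_carrier:
  "matricization ns i T \<in> carrier_mat (prod_list (take i ns)) (prod_list (drop i ns))"
  by (simp add: matricization_def)

lemma matricization_index:
  "p < prod_list (take i ns) \<Longrightarrow> q < prod_list (drop i ns) \<Longrightarrow>
    matricization ns i T $$ (p, q) = T (multi_indices (take i ns) ! p @ multi_indices (drop i ns) ! q)"
  by (simp add: matricization_def)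

lemma matricization_index_pos:
  assumes "js \<in> set (multi_indices ns)"
  shows "T js = matricization ns i T $$
    (multi_index_pos (take i ns) (take i js), multi_index_pos (drop i ns) (drop i js))"
  using assms
  by (simp add: matricization_index multi_index_pos_less take_multi_indices drop_multi_indices)

text \<open>A rank bound as separation of variables over multi-indices. In this form an operator on
  fewer leading factors can be followed without Kronecker products.\<close>

lemma mat_rank_matricization_le_iff:
  "mat_rank (matricization ns i T) \<le> r \<longleftrightarrow>
    (\<exists>u v. \<forall>a\<in>set (multi_indices (take i ns)). \<forall>b\<in>set (multi_indices (drop i ns)).
      T (a @ b) = (\<Sum>l<r. u a l * v l b))"
proof -
  let ?a = "take i ns" and ?b = "drop i ns"
  let ?m = "prod_list ?a" and ?n = "prod_list ?b"
  show ?thesis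
  proof
    assume "mat_rank (matricization ns i T) \<le> r"
    then obtain U V where U: "U \<in> carrier_mat ?m r" and V: "V \<in> carrier_mat r ?n"
      and UV: "matricization ns i T = U * V"
      unfolding mat_rank_le_iff low_rank_def carrier_matD[OF matricization_carrier] by blast
    have "T (a @ b) = (\<Sum>l<r. U $$ (multi_index_pos ?a a, l) * V $$ (l, multi_index_pos ?b b))"
      if "a \<in> set (multi_indices ?a)" "b \<in> set (multi_indices ?b)" for a b
    proof -
      have "T (a @ b) = matricization ns i T $$ (multi_index_pos ?a a, multi_index_pos ?b b)"
        using that by (simp add: matricization_index multi_index_pos_less)
      also have "\<dots> = (\<Sum>l<r. U $$ (multi_index_pos ?a a, l) * V $$ (l, multi_index_pos ?b b))"
        using that U V multi_index_pos_less(1)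
        unfolding UV by (simp add: scalar_prod_def atLeast0LessThan)
      finally show ?thesis .
    qed
    then show "\<exists>u v. \<forall>a\<in>set (multi_indices ?a). \<forall>b\<in>set (multi_indices ?b).
        T (a @ b) = (\<Sum>l<r. u a l * v l b)"
      by (intro exI[of _ "\<lambda>a l. U $$ (multi_index_pos ?a a, l)"]
          exI[of _ "\<lambda>l b. V $$ (l, multi_index_pos ?b b)"]) blast
  next
    assume "\<exists>u v. \<forall>a\<in>set (multi_indices ?a). \<forall>b\<in>set (multi_indices ?b).
        T (a @ b) = (\<Sum>l<r. u a l * v l b)"
    then obtain u v where uv: "\<And>a b. a \<in> set (multi_indices ?a) \<Longrightarrow> b \<in> set (multi_indices ?b) \<Longrightarrow>
        T (a @ b) = (\<Sum>l<r. u a l * v l b)" by blast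
    let ?U = "mat ?m r (\<lambda>(p, l). u (multi_indices ?a ! p) l)"
    let ?V = "mat r ?n (\<lambda>(l, q). v l (multi_indices ?b ! q))"
    have "matricization ns i T = ?U * ?V"
    proof (rule eq_matI)
      fix p q assume "p < dim_row (?U * ?V)" "q < dim_col (?U * ?V)"
      then have pq: "p < ?m" "q < ?n" by auto
      then show "matricization ns i T $$ (p, q) = (?U * ?V) $$ (p, q)"
        by (simp add: matricization_index uv nth_multi_indices scalar_prod_def atLeast0LessThan)
    qed (simp_all add: matricization_def)
    then show "mat_rank (matricization ns i T) \<le> r"
      using mat_rank_le_if_mult[of ?U ?m r ?V ?n] by simp
  qed
qed

section \<open>Operators on the leading tensor factors\<close>

text \<open>This is \<open>P\<close> tensored with the identity on the remaining factors. The value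
  0 off the multi-indices keeps the result inside \<open>tensors ns\<close>.\<close>

definition act :: "nat list \<Rightarrow> nat \<Rightarrow> real mat \<Rightarrow> tensor \<Rightarrow> tensor" where
  "act ns i P T js = (if js \<in> set (multi_indices ns)
     then \<Sum>q<prod_list (take i ns). P $$ (multi_index_pos (take i ns) (take i js), q) *
            T (multi_indices (take i ns) ! q @ drop i js)
     else 0)"

lemma act_in_tensors: "act ns i P T \<in> tensors ns"
  by (simp add: tensors_def act_def)

lemma matricization_act:
  assumes P: "P \<in> carrier_mat (prod_list (take i ns)) (prod_list (take i ns))"
  shows "matricization ns i (act ns i P T) = P * matricization ns i T"
proof (rule eq_matI)
  let ?a = "take i ns" and ?b = "drop i ns"
  let ?m = "prod_list ?a" and ?n = "prod_list ?b"
  show dims: "dim_row (matricization ns i (act ns i P T)) = dim_row (P * matricization ns i T)"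
    "dim_col (matricization ns i (act ns i P T)) = dim_col (P * matricization ns i T)"
    using P by (simp_all add: matricization_def)
  fix p q assume "p < dim_row (P * matricization ns i T)" "q < dim_col (P * matricization ns i T)"
  then have pq: "p < ?m" "q < ?n" using P by (simp_all add: matricization_def)
  define a b where "a = multi_indices ?a ! p" and "b = multi_indices ?b ! q"
  have ab: "a \<in> set (multi_indices ?a)" "b \<in> set (multi_indices ?b)"
    using pq by (simp_all add: a_def b_def nth_multi_indices)
  have len: "length a = min i (length ns)"
    using length_in_multi_indices[OF ab(1)] by simp
  \<comment> \<open>For \<open>i\<close> beyond the number of factors, \<open>a\<close> is shorter
    than \<open>i\<close>; then \<open>b\<close> is empty and the splitting is still
    correct.\<close>
  have td: "take i (a @ b) = a" "drop i (a @ b) = b"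
  proof -
    have "b = []" if "length ns < i" using that length_in_multi_indices[OF ab(2)] by simp
    then show "take i (a @ b) = a" "drop i (a @ b) = b" using len by (cases "i \<le> length ns"; simp)+
  qed
  have "act ns i P T (a @ b) = (\<Sum>l<?m. P $$ (p, l) * T (multi_indices ?a ! l @ b))"
    using append_multi_indices[OF ab] td pq by (simp add: act_def) (simp add: a_def multi_index_pos_nth)
  also have "\<dots> = (P * matricization ns i T) $$ (p, q)"
    using pq P matricization_carrier[of ns i T]
    by (simp add: scalar_prod_def atLeast0LessThan matricization_index b_def)
  finally show "matricization ns i (act ns i P T) $$ (p, q) = (P * matricization ns i T) $$ (p, q)"
    using pq by (simp add: matricization_index a_def b_def)
qed

lemma mat_rank_act_same:
  assumes P: "P \<in> carrier_mat (prod_list (take i ns)) (prod_list (take i ns))" and r: "mat_rank P \<le> r"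
  shows "mat_rank (matricization ns i (act ns i P T)) \<le> r"
  unfolding matricization_act[OF P] mat_rank_le_iff
  by (rule low_rank_mult_right[where q = "prod_list (drop i ns)"])
    (use P r matricization_carrier[of ns i T] in \<open>auto simp: mat_rank_le_iff\<close>)

text \<open>An operator on the first \<open>j\<close> tensor factors acts on the \<open>i\<close>-th matricization, \<open>j \<le> i\<close>,
  by a left multiplication.\<close>

lemma mat_rank_act_later:
  assumes ji: "j \<le> i" "i \<le> length ns" and r: "mat_rank (matricization ns i T) \<le> r"
  shows "mat_rank (matricization ns i (act ns j P T)) \<le> r"
proof -
  let ?a = "take i ns" and ?b = "drop i ns" and ?c = "take j ns"
  let ?m = "prod_list ?c"
  obtain u v where uv: "\<And>a b. a \<in> set (multi_indices ?a) \<Longrightarrow> b \<in> set (multi_indices ?b) \<Longrightarrow>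
      T (a @ b) = (\<Sum>l<r. u a l * v l b)"
    using r unfolding mat_rank_matricization_le_iff by blast
  \<comment> \<open>The operator sees only the first \<open>j\<close> entries of the row index, so
    it is absorbed into the left factor \<open>u\<close> while \<open>v\<close> stays.\<close>
  define w where "w a l = (\<Sum>q<?m. P $$ (multi_index_pos ?c (take j a), q) *
      u (multi_indices ?c ! q @ drop j a) l)" for a l
  have "act ns j P T (a @ b) = (\<Sum>l<r. w a l * v l b)"
    if a: "a \<in> set (multi_indices ?a)" and b: "b \<in> set (multi_indices ?b)" for a b
  proof -
    have len: "j \<le> length a" using length_in_multi_indices[OF a] ji by simp
    have mem: "multi_indices ?c ! q @ drop j a \<in> set (multi_indices ?a)" if "q < ?m" for q
    proof (rule append_multi_indices[where i = j])
      show "multi_indices ?c ! q \<in> set (multi_indices (take j ?a))"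
        using nth_multi_indices[OF that] ji by (simp add: min_absorb1)
    qed (rule drop_multi_indices[OF a])
    have "act ns j P T (a @ b) = (\<Sum>q<?m. P $$ (multi_index_pos ?c (take j a), q) *
        T ((multi_indices ?c ! q @ drop j a) @ b))"
      using append_multi_indices[OF a b] len by (simp add: act_def)
    also have "\<dots> = (\<Sum>q<?m. \<Sum>l<r. P $$ (multi_index_pos ?c (take j a), q) *
        (u (multi_indices ?c ! q @ drop j a) l * v l b))"
    proof (rule sum.cong[OF refl])
      fix q assume "q \<in> {..<?m}"
      then have "T ((multi_indices ?c ! q @ drop j a) @ b) =
          (\<Sum>l<r. u (multi_indices ?c ! q @ drop j a) l * v l b)"
        using uv[OF mem b] by simp
      then show "P $$ (multi_index_pos ?c (take j a), q) * T ((multi_indices ?c ! q @ drop j a) @ b) =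
          (\<Sum>l<r. P $$ (multi_index_pos ?c (take j a), q) *
            (u (multi_indices ?c ! q @ drop j a) l * v l b))"
        by (simp only: sum_distrib_left)
    qed
    also have "\<dots> = (\<Sum>l<r. w a l * v l b)"
      unfolding w_def sum_distrib_right mult.assoc by (rule sum.swap)
    finally show ?thesis .
  qed
  then show ?thesis unfolding mat_rank_matricization_le_iff by blast
qed

text \<open>\<open>foldr\<close> applies the last element of the list first. In a sorted list, every
  operator applied after the one for \<open>i\<close> therefore has an index at most
  \<open>i\<close> and keeps the bound already reached.\<close>

lemma mat_rank_foldr_act:
  assumes "sorted xs" "set xs \<subseteq> {..length ns}"
    and "\<And>i. i \<in> set xs \<Longrightarrow> W i \<in> carrier_mat (prod_list (take i ns)) (prod_list (take i ns))"
    and "\<And>i. i \<in> set xs \<Longrightarrow> mat_rank (W i) \<le> r i" and "i \<in> set xs"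
  shows "mat_rank (matricization ns i (foldr (\<lambda>i. act ns i (W i)) xs T)) \<le> r i"
  using assms
proof (induction xs)
  case (Cons x xs)
  show ?case
  proof (cases "i = x")
    case True
    then show ?thesis using Cons.prems by (simp add: mat_rank_act_same)
  next
    case False
    then have "i \<in> set xs" "x \<le> i" "i \<le> length ns" using Cons.prems by auto
    moreover from this have "mat_rank (matricization ns i (foldr (\<lambda>i. act ns i (W i)) xs T)) \<le> r i"
      using Cons.prems by (intro Cons.IH) auto
    ultimately show ?thesis by (simp add: mat_rank_act_later)
  qed
qed simp

text \<open>With \<open>F\<close> the result so far, \<open>W F - Y = W (F - Y) + (W Y - Y)\<close>.
  The first term is \<open>o(t)\<close> by induction, as the entries of \<open>W\<close> converge;
  the second is \<open>o(t)\<close> by assumption. \<open>W\<close> mixes entries, so the induction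
  hypothesis is needed at all multi-indices.\<close>

lemma foldr_act_tendsto:
  fixes t :: "nat \<Rightarrow> real" and Y :: "nat \<Rightarrow> tensor"
  assumes t: "\<And>m. t m \<noteq> 0" and Y: "\<And>m. Y m \<in> tensors ns"
    and W: "\<And>i p q. i \<in> set xs \<Longrightarrow> p < prod_list (take i ns) \<Longrightarrow> q < prod_list (take i ns) \<Longrightarrow>
      convergent (\<lambda>m. W m i $$ (p, q))"
    and act: "\<And>i js. i \<in> set xs \<Longrightarrow> js \<in> set (multi_indices ns) \<Longrightarrow>
      (\<lambda>m. (act ns i (W m i) (Y m) js - Y m js) / t m) \<longlonglongrightarrow> 0"
  shows "(\<lambda>m. (foldr (\<lambda>i. act ns i (W m i)) xs (Y m) js - Y m js) / t m) \<longlonglongrightarrow> 0"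
  using W act
proof (induction xs arbitrary: js)
  case (Cons x xs)
  let ?F = "\<lambda>m. foldr (\<lambda>i. act ns i (W m i)) xs (Y m)"
  have IH: "(\<lambda>m. (?F m js - Y m js) / t m) \<longlonglongrightarrow> 0" for js
    by (rule Cons.IH) (use Cons.prems in auto)
  show ?case
  proof (cases "js \<in> set (multi_indices ns)")
    case False
    then have "Y m js = 0" for m using Y[of m] by (simp add: tensors_def)
    with False show ?thesis by (simp add: act_def)
  next
    case True
    let ?c = "take x ns"
    let ?m = "prod_list ?c"
    let ?p = "multi_index_pos ?c (take x js)"
    let ?j = "\<lambda>q. multi_indices ?c ! q @ drop x js"
    have p: "?p < ?m" by (rule multi_index_pos_less(1)[OF take_multi_indices[OF True]])
    have "(\<lambda>m. W m x $$ (?p, q) * ((?F m (?j q) - Y m (?j q)) / t m)) \<longlonglongrightarrow> 0" if q: "q < ?m" for q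
    proof -
      obtain w where "(\<lambda>m. W m x $$ (?p, q)) \<longlonglongrightarrow> w"
        using Cons.prems(1)[of x ?p q] p q by (auto simp: convergent_def)
      from tendsto_mult[OF this IH] show ?thesis by simp
    qed
    then have "(\<lambda>m. \<Sum>q<?m. W m x $$ (?p, q) * ((?F m (?j q) - Y m (?j q)) / t m)) \<longlonglongrightarrow> 0"
      by (intro tendsto_null_sum) auto
    moreover have "(\<lambda>m. (act ns x (W m x) (Y m) js - Y m js) / t m) \<longlonglongrightarrow> 0"
      using Cons.prems(2) True by simp
    ultimately have "(\<lambda>m. (\<Sum>q<?m. W m x $$ (?p, q) * ((?F m (?j q) - Y m (?j q)) / t m)) +
        (act ns x (W m x) (Y m) js - Y m js) / t m) \<longlonglongrightarrow> 0 + 0"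
      by (rule tendsto_add)
    moreover have "(\<Sum>q<?m. W m x $$ (?p, q) * ((?F m (?j q) - Y m (?j q)) / t m)) +
        (act ns x (W m x) (Y m) js - Y m js) / t m =
        (foldr (\<lambda>i. act ns i (W m i)) (x # xs) (Y m) js - Y m js) / t m" for m
    proof -
      have "(\<Sum>q<?m. W m x $$ (?p, q) * ((?F m (?j q) - Y m (?j q)) / t m)) =
          (act ns x (W m x) (?F m) js - act ns x (W m x) (Y m) js) / t m"
        using True by (simp add: act_def sum_subtractf[symmetric] sum_divide_distrib right_diff_distrib)
      then show ?thesis by (simp add: add_divide_distrib[symmetric])
    qed
    ultimately show ?thesis by simp
  qed
qed simp

text \<open>The curve is sampled at \<open>t = 1 / (m + 1)\<close> with multipliers
  \<open>1 / t\<close>. It differs by \<open>o(t)\<close> from the line \<open>Y = A + t X\<close>,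
  which lies in general outside the variety.\<close>

lemma tangent_curve:
  assumes X: "X \<in> tensors ns" and A: "A \<in> tensors ns"
    and W0: "\<And>i. i \<in> {1..<length ns} \<Longrightarrow> W0 i \<in> carrier_mat (prod_list (take i ns)) (prod_list (take i ns))"
    and W1: "\<And>i. i \<in> {1..<length ns} \<Longrightarrow> W1 i \<in> carrier_mat (prod_list (take i ns)) (prod_list (take i ns))"
    and Z: "\<And>i. i \<in> {1..<length ns} \<Longrightarrow> Z i \<in> carrier_mat (prod_list (take i ns)) (prod_list (drop i ns))"
    and r: "\<And>i t. i \<in> {1..<length ns} \<Longrightarrow> mat_rank (W0 i + t \<cdot>\<^sub>m W1 i) \<le> r i"
    and eq: "\<And>i t. i \<in> {1..<length ns} \<Longrightarrow>
      (W0 i + t \<cdot>\<^sub>m W1 i) * (matricization ns i A + t \<cdot>\<^sub>m matricization ns i X) =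
      matricization ns i A + t \<cdot>\<^sub>m matricization ns i X + t\<^sup>2 \<cdot>\<^sub>m Z i"
  shows "X \<in> tangent_cone ns (TT_variety ns r) A"
proof -
  define t where "t m = inverse (real (Suc m))" for m
  have t0: "t m \<noteq> 0" for m by (simp add: t_def)
  have tlim: "t \<longlonglongrightarrow> 0" unfolding t_def by (rule LIMSEQ_inverse_real_of_nat)
  define Y where "Y m js = A js + t m * X js" for m js
  have Y: "Y m \<in> tensors ns" for m using X A by (simp add: tensors_def Y_def)
  define W where "W m i = W0 i + t m \<cdot>\<^sub>m W1 i" for m i
  let ?xs = "[1..<length ns]"
  define F where "F m = foldr (\<lambda>i. act ns i (W m i)) ?xs (Y m)" for m
  have WC: "W m i \<in> carrier_mat (prod_list (take i ns)) (prod_list (take i ns))"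
    if "i \<in> {1..<length ns}" for m i using W0[OF that] W1[OF that] by (simp add: W_def)
  have FT: "F m \<in> tensors ns" for m
    using Y act_in_tensors unfolding F_def by (cases ?xs) auto
  have FV: "F m \<in> TT_variety ns r" for m
  proof -
    have "mat_rank (matricization ns i (F m)) \<le> r i" if i: "i \<in> {1..<length ns}" for i
      unfolding F_def
    proof (rule mat_rank_foldr_act)
      show "mat_rank (W m j) \<le> r j" if "j \<in> set ?xs" for j
        using r[of j "t m"] that by (simp add: W_def)
    qed (use i WC in auto)
    then show ?thesis using FT by (simp add: TT_variety_def)
  qed
  have FY: "(\<lambda>m. (F m js - Y m js) / t m) \<longlonglongrightarrow> 0" for js
    unfolding F_def
  proof (rule foldr_act_tendsto[OF t0 Y])
    fix i p q assume i: "i \<in> set ?xs" and pq: "p < prod_list (take i ns)" "q < prod_list (take i ns)"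
    then have "W m i $$ (p, q) = W0 i $$ (p, q) + t m * W1 i $$ (p, q)" for m
      using W0[of i] W1[of i] by (simp add: W_def)
    then have "(\<lambda>m. W m i $$ (p, q)) \<longlonglongrightarrow> W0 i $$ (p, q) + 0 * W1 i $$ (p, q)"
      by (simp only:) (intro tendsto_intros tlim)
    then show "convergent (\<lambda>m. W m i $$ (p, q))" by (rule convergentI)
  next
    fix i js assume i: "i \<in> set ?xs" and js: "js \<in> set (multi_indices ns)"
    then have i': "i \<in> {1..<length ns}" by simp
    let ?p = "multi_index_pos (take i ns) (take i js)" and ?q = "multi_index_pos (drop i ns) (drop i js)"
    have pq: "?p < prod_list (take i ns)" "?q < prod_list (drop i ns)"
      using js by (simp_all add: multi_index_pos_less take_multi_indices drop_multi_indices)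
    \<comment> \<open>The pencil moves the line by \<open>t^2 Z\<close>, which is still of order
      \<open>t\<close> after division by \<open>t\<close>.\<close>
    have "(act ns i (W m i) (Y m) js - Y m js) / t m = t m * Z i $$ (?p, ?q)" for m
    proof -
      have MY: "matricization ns i (Y m) = matricization ns i A + t m \<cdot>\<^sub>m matricization ns i X"
        by (rule eq_matI) (simp_all add: matricization_def Y_def)
      have "matricization ns i (act ns i (W m i) (Y m)) = matricization ns i (Y m) + (t m)\<^sup>2 \<cdot>\<^sub>m Z i"
        unfolding matricization_act[OF WC[OF i']] unfolding MY W_def by (rule eq[OF i'])
      then have "act ns i (W m i) (Y m) js = (matricization ns i (Y m) + (t m)\<^sup>2 \<cdot>\<^sub>m Z i) $$ (?p, ?q)"
        using matricization_index_pos[OF js, of "act ns i (W m i) (Y m)" i] by simp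
      also have "\<dots> = Y m js + (t m)\<^sup>2 * Z i $$ (?p, ?q)"
        using pq Z[OF i'] matricization_index_pos[OF js, of "Y m" i] by simp
      finally show ?thesis using t0[of m] by (simp add: power2_eq_square)
    qed
    moreover have "(\<lambda>m. t m * Z i $$ (?p, ?q)) \<longlonglongrightarrow> 0 * Z i $$ (?p, ?q)"
      by (intro tendsto_intros tlim)
    ultimately show "(\<lambda>m. (act ns i (W m i) (Y m) js - Y m js) / t m) \<longlonglongrightarrow> 0" by simp
  qed
  define a where "a m = real (Suc m)" for m
  have a: "a m * z = z / t m" for m z by (simp add: a_def t_def divide_inverse)
  have aF: "(\<lambda>m. a m * (F m js - A js)) \<longlonglongrightarrow> X js" for js
  proof -
    have "a m * (F m js - A js) = (F m js - Y m js) / t m + X js" for m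
      using t0[of m] by (simp add: a Y_def field_simps)
    then show ?thesis using tendsto_add[OF FY tendsto_const, of js "X js"] by simp
  qed
  \<comment> \<open>Convergence to \<open>A\<close> follows from \<open>aF\<close>: the difference
    is \<open>t\<close> times a convergent sequence.\<close>
  have FA: "(\<lambda>m. F m js) \<longlonglongrightarrow> A js" for js
  proof -
    have "F m js = t m * (a m * (F m js - A js)) + A js" for m
      using t0[of m] by (simp add: a)
    moreover have "(\<lambda>m. t m * (a m * (F m js - A js)) + A js) \<longlonglongrightarrow> 0 * X js + A js"
      by (intro tendsto_intros tlim aF)
    ultimately show ?thesis by simp
  qed
  show ?thesis
    unfolding tangent_cone_def tendsto_tensor_iff
    by (intro CollectI conjI X exI[of _ F] exI[of _ a] allI FV FA aF) (simp add: a_def)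
qed

section \<open>Minors as polynomials\<close>

lemma tensor_polynomial_sum:
  assumes "\<And>i. i \<in> I \<Longrightarrow> tensor_polynomial ns (f i)"
  shows "tensor_polynomial ns (\<lambda>X. \<Sum>i\<in>I. f i X)"
  using assms
  by (induction I rule: infinite_finite_induct) (auto intro: tensor_polynomial.intros)

lemma tensor_polynomial_prod:
  assumes "\<And>i. i \<in> I \<Longrightarrow> tensor_polynomial ns (f i)"
  shows "tensor_polynomial ns (\<lambda>X. \<Prod>i\<in>I. f i X)"
  using assms
  by (induction I rule: infinite_finite_induct) (auto intro: tensor_polynomial.intros)

lemma tensor_polynomial_det:
  assumes K: "\<And>X. K X \<in> carrier_mat n n"
    and p: "\<And>i j. i < n \<Longrightarrow> j < n \<Longrightarrow> tensor_polynomial ns (\<lambda>X. K X $$ (i, j))"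
  shows "tensor_polynomial ns (\<lambda>X. det (K X))"
  unfolding det_def'[OF K]
  by (intro tensor_polynomial_sum tensor_polynomial.mult tensor_polynomial.const tensor_polynomial_prod p)
    (auto dest: permutes_in_image)

lemma tensor_polynomial_projected:
  fixes P Q :: "real mat"
  assumes P: "P \<in> carrier_mat (prod_list (take i ns)) (prod_list (take i ns))"
    and Q: "Q \<in> carrier_mat (prod_list (drop i ns)) (prod_list (drop i ns))"
    and pq: "p < prod_list (take i ns)" "q < prod_list (drop i ns)"
  shows "tensor_polynomial ns (\<lambda>X. (P * matricization ns i X * Q) $$ (p, q))"
proof -
  let ?m = "prod_list (take i ns)" and ?n = "prod_list (drop i ns)"
  have "(P * matricization ns i X * Q) $$ (p, q) =
    (\<Sum>l<?n. (\<Sum>h<?m. P $$ (p, h) * matricization ns i X $$ (h, l)) * Q $$ (l, q))" for X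
    using P Q pq carrier_matD[OF matricization_carrier[of ns i X]]
    by (simp add: scalar_prod_def atLeast0LessThan)
  moreover have "tensor_polynomial ns (\<lambda>X. matricization ns i X $$ (h, l))"
    if "h < ?m" "l < ?n" for h l
    unfolding matricization_index[OF that]
    by (intro tensor_polynomial.coordinate append_multi_indices[where i = i] nth_multi_indices that)
  ultimately show ?thesis
    by (simp only:) (intro tensor_polynomial_sum tensor_polynomial.mult tensor_polynomial.const; simp)
qed

text \<open>\<open>I\<close> and \<open>J\<close> are fixed, so \<open>pick\<close> selects the same
  entries for every \<open>X\<close>, and the Leibniz formula applies to them.\<close>

lemma tensor_polynomial_minor:
  assumes K: "\<And>X. K X \<in> carrier_mat m n"
    and p: "\<And>i j. i < m \<Longrightarrow> j < n \<Longrightarrow> tensor_polynomial ns (\<lambda>X. K X $$ (i, j))"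
    and IJ: "I \<subseteq> {..<m}" "card I = r" "J \<subseteq> {..<n}" "card J = r"
  shows "tensor_polynomial ns (\<lambda>X. det (submatrix (K X) I J))"
proof -
  have eqs: "{i. i < m \<and> i \<in> I} = I" "{j. j < n \<and> j \<in> J} = J" using IJ by auto
  show ?thesis
  proof (rule tensor_polynomial_det)
    show "submatrix (K X) I J \<in> carrier_mat r r" for X
      by (rule carrier_matI) (simp_all only: dim_submatrix carrier_matD[OF K] eqs IJ)
    fix i j assume ij: "i < r" "j < r"
    then have "pick I i \<in> I" "pick J j \<in> J" using IJ by (auto intro: pick_in_set_le)
    then have "pick I i < m" "pick J j < n" using IJ by auto
    moreover have "submatrix (K X) I J $$ (i, j) = K X $$ (pick I i, pick J j)" for X
      by (rule submatrix_index) (simp_all only: carrier_matD[OF K] eqs IJ ij)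
    ultimately show "tensor_polynomial ns (\<lambda>X. submatrix (K X) I J $$ (i, j))" using p by simp
  qed
qed

section \<open>The tangent cone of the TT variety\<close>

theorem mainTheorem6:
  fixes d :: nat and ns :: "nat list" and k s :: "nat \<Rightarrow> nat"
    and A :: tensor and B C :: "nat \<Rightarrow> real mat"
  assumes "d \<ge> 2"
    and "length ns = d"
    and "\<forall>n\<in>set ns. n > 0"
    and "A \<in> TT_manifold ns k"
    and "\<forall>i\<in>{1..<d}. B i \<in> carrier_mat (prod_list (take i ns)) (k i)"
    and "\<forall>i\<in>{1..<d}. C i \<in> carrier_mat (k i) (prod_list (drop i ns))"
    and "\<forall>i\<in>{1..<d}. matricization ns i A = B i * C i"
  shows "tangent_cone ns (TT_variety ns (\<lambda>i. k i + s i)) A =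
           {X \<in> tensors ns. \<forall>i\<in>{1..<d}.
              mat_rank ((1\<^sub>m (prod_list (take i ns)) - B i * pinv (B i)) * matricization ns i X *
                        (1\<^sub>m (prod_list (drop i ns)) - pinv (C i) * C i)) \<le> s i}
       \<and> (\<forall>p\<in>minor_system ns s B C. tensor_polynomial ns p)
       \<and> tangent_cone ns (TT_variety ns (\<lambda>i. k i + s i)) A =
           {X \<in> tensors ns. \<forall>p\<in>minor_system ns s B C. p X = 0}"
proof -
  let ?m = "\<lambda>i. prod_list (take i ns)" and ?n = "\<lambda>i. prod_list (drop i ns)"
  let ?V = "TT_variety ns (\<lambda>i. k i + s i)"
  have A: "A \<in> tensors ns" using assms(4) by (simp add: TT_manifold_def)
  have BC: "matricization ns i A = B i * C i" if "i \<in> {1..<d}" for i using assms(7) that by blast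
  \<comment> \<open>Membership in the manifold gives rank exactly \<open>k i\<close>, which forces
    the given factors \<open>B i\<close> and \<open>C i\<close> to have full rank.\<close>
  have loc: "rank_factors (?m i) (?n i) (k i) (B i) (C i)" if "i \<in> {1..<d}" for i
  proof
    show "B i \<in> carrier_mat (?m i) (k i)" "C i \<in> carrier_mat (k i) (?n i)" using assms(5,6) that by blast+
    show "mat_rank (B i * C i) = k i"
      using assms(2,4) that BC[OF that, symmetric] by (simp add: TT_manifold_def)
  qed
  define L where "L i = 1\<^sub>m (?m i) - B i * pinv (B i)" for i
  define R where "R i = 1\<^sub>m (?n i) - pinv (C i) * C i" for i
  have LR: "L i = rank_factors.L (?m i) (B i)" "R i = rank_factors.R (?n i) (C i)"
    if "i \<in> {1..<d}" for i
    using loc[OF that] by (simp_all add: L_def R_def rank_factors.L_def rank_factors.R_def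
        rank_factors.b_def rank_factors.c_def)
  have Lc: "L i \<in> carrier_mat (?m i) (?m i)" and Rc: "R i \<in> carrier_mat (?n i) (?n i)"
    if "i \<in> {1..<d}" for i
    unfolding LR[OF that] using rank_factors.carriers[OF loc[OF that]] by blast+
  have cone: "tangent_cone ns ?V A =
    {X \<in> tensors ns. \<forall>i\<in>{1..<d}. mat_rank (L i * matricization ns i X * R i) \<le> s i}"
  proof (intro equalityI subsetI)
    fix X assume X: "X \<in> tangent_cone ns ?V A"
    then obtain x a where xV: "\<And>l. x l \<in> ?V" and xA: "x \<longlonglongrightarrow> A"
      and xX: "(\<lambda>l js. a l * (x l js - A js)) \<longlonglongrightarrow> X"
      unfolding tangent_cone_def by blast
    note xA' = xA[unfolded tendsto_tensor_iff, rule_format]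
      and xX' = xX[unfolded tendsto_tensor_iff, rule_format]
    have "mat_rank (L i * matricization ns i X * R i) \<le> s i" if i: "i \<in> {1..<d}" for i
      unfolding LR[OF i]
    proof (rule rank_factors.rank_le_if_tangent[OF loc[OF i]])
      show "matricization ns i (x l) \<in> carrier_mat (?m i) (?n i)" for l by (rule matricization_carrier)
      show "matricization ns i X \<in> carrier_mat (?m i) (?n i)" by (rule matricization_carrier)
      show "mat_rank (matricization ns i (x l)) \<le> k i + s i" for l
        using xV[of l] i assms(2) by (simp add: TT_variety_def)
      fix p q assume pq: "p < ?m i" "q < ?n i"
      show "(\<lambda>l. matricization ns i (x l) $$ (p, q)) \<longlonglongrightarrow> (B i * C i) $$ (p, q)"
        unfolding BC[OF i, symmetric] matricization_index[OF pq] by (rule xA')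
      show "(\<lambda>l. a l * (matricization ns i (x l) $$ (p, q) - (B i * C i) $$ (p, q)))
          \<longlonglongrightarrow> matricization ns i X $$ (p, q)"
        unfolding BC[OF i, symmetric] matricization_index[OF pq] by (rule xX')
    qed
    then show "X \<in> {X \<in> tensors ns. \<forall>i\<in>{1..<d}. mat_rank (L i * matricization ns i X * R i) \<le> s i}"
      using X by (simp add: tangent_cone_def)
  next
    fix X assume "X \<in> {X \<in> tensors ns. \<forall>i\<in>{1..<d}. mat_rank (L i * matricization ns i X * R i) \<le> s i}"
    then have X: "X \<in> tensors ns"
      and r: "\<And>i. i \<in> {1..<d} \<Longrightarrow> mat_rank (L i * matricization ns i X * R i) \<le> s i" by blast+
    \<comment> \<open>One pencil per \<open>i\<close>, valid for all \<open>t\<close>; the choice of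
      families \<open>P0\<close>, \<open>P1\<close>, \<open>Z\<close> is then the input of
      \<open>tangent_curve\<close>.\<close>
    have "\<exists>P0 P1 Z. P0 \<in> carrier_mat (?m i) (?m i) \<and> P1 \<in> carrier_mat (?m i) (?m i) \<and>
        Z \<in> carrier_mat (?m i) (?n i) \<and> (\<forall>t. mat_rank (P0 + t \<cdot>\<^sub>m P1) \<le> k i + s i) \<and>
        (\<forall>t. (P0 + t \<cdot>\<^sub>m P1) * (matricization ns i A + t \<cdot>\<^sub>m matricization ns i X) =
          matricization ns i A + t \<cdot>\<^sub>m matricization ns i X + t\<^sup>2 \<cdot>\<^sub>m Z)"
      if i: "i \<in> {1..<d}" for i
    proof -
      show ?thesis
        unfolding BC[OF i]
        by (rule rank_factors.low_rank_pencil[OF loc[OF i] matricization_carrier[of ns i X]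
              r[OF i, unfolded LR[OF i]]]) blast
    qed
    then obtain P0 P1 Z where
      "\<And>i. i \<in> {1..<d} \<Longrightarrow> P0 i \<in> carrier_mat (?m i) (?m i)"
      "\<And>i. i \<in> {1..<d} \<Longrightarrow> P1 i \<in> carrier_mat (?m i) (?m i)"
      "\<And>i. i \<in> {1..<d} \<Longrightarrow> Z i \<in> carrier_mat (?m i) (?n i)"
      "\<And>i t. i \<in> {1..<d} \<Longrightarrow> mat_rank (P0 i + t \<cdot>\<^sub>m P1 i) \<le> k i + s i"
      "\<And>i t. i \<in> {1..<d} \<Longrightarrow>
        (P0 i + t \<cdot>\<^sub>m P1 i) * (matricization ns i A + t \<cdot>\<^sub>m matricization ns i X) =
        matricization ns i A + t \<cdot>\<^sub>m matricization ns i X + t\<^sup>2 \<cdot>\<^sub>m Z i"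
      by metis
    then show "X \<in> tangent_cone ns ?V A"
      using assms(2) by (intro tangent_curve[OF X A, of P0 P1 Z]) simp_all
  qed
  have proj: "projected_matricization ns i (B i) (C i) X = L i * matricization ns i X * R i" for i X
    by (simp add: projected_matricization_def L_def R_def)
  have pc: "L i * matricization ns i X * R i \<in> carrier_mat (?m i) (?n i)" if "i \<in> {1..<d}" for i X
    by (intro mult_carrier_mat[OF mult_carrier_mat[OF Lc[OF that] matricization_carrier] Rc[OF that]])
  have minors: "(\<forall>p\<in>minor_system ns s B C. p X = 0) \<longleftrightarrow>
    (\<forall>i\<in>{1..<d}. mat_rank (L i * matricization ns i X * R i) \<le> s i)" for X
  proof -
    have "(\<forall>p\<in>minor_system ns s B C. p X = 0) \<longleftrightarrow> (\<forall>i\<in>{1..<d}. \<forall>I J.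
      I \<subseteq> {..<?m i} \<and> card I = s i + 1 \<and> J \<subseteq> {..<?n i} \<and> card J = s i + 1 \<longrightarrow>
      det (submatrix (L i * matricization ns i X * R i) I J) = 0)"
    proof (intro iffI ballI allI impI)
      fix i I J assume z: "\<forall>p\<in>minor_system ns s B C. p X = 0" and i: "i \<in> {1..<d}"
        and IJ: "I \<subseteq> {..<?m i} \<and> card I = s i + 1 \<and> J \<subseteq> {..<?n i} \<and> card J = s i + 1"
      have
        "(\<lambda>X. det (submatrix (L i * matricization ns i X * R i) I J)) \<in> minor_system ns s B C"
        unfolding minor_system_def proj assms(2) using i IJ by blast
      from bspec[OF z this]
      show "det (submatrix (L i * matricization ns i X * R i) I J) = 0" .
    next
      fix p assume *: "\<forall>i\<in>{1..<d}. \<forall>I J.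
        I \<subseteq> {..<?m i} \<and> card I = s i + 1 \<and> J \<subseteq> {..<?n i} \<and> card J = s i + 1 \<longrightarrow>
        det (submatrix (L i * matricization ns i X * R i) I J) = 0"
        and "p \<in> minor_system ns s B C"
      then obtain i I J where p: "p = (\<lambda>X. det (submatrix (L i * matricization ns i X * R i) I J))"
        and "i \<in> {1..<d}" "I \<subseteq> {..<?m i} \<and> card I = s i + 1 \<and> J \<subseteq> {..<?n i} \<and> card J = s i + 1"
        unfolding minor_system_def proj assms(2) by blast
      with * show "p X = 0" by blast
    qed
    \<comment> \<open>By \<open>pc\<close> the dimensions of the projected matricization are the two
      products of mode sizes, so the index ranges of the minor criterion match those of
      \<open>minor_system\<close>.\<close>
    also have "\<dots> \<longleftrightarrow> (\<forall>i\<in>{1..<d}. mat_rank (L i * matricization ns i X * R i) \<le> s i)"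
      unfolding mat_rank_le_iff_minors by (intro ball_cong refl) (simp only: carrier_matD[OF pc])
    finally show ?thesis .
  qed
  have "tensor_polynomial ns p" if pm: "p \<in> minor_system ns s B C" for p
  proof -
    obtain i I J where p: "p = (\<lambda>X. det (submatrix (L i * matricization ns i X * R i) I J))"
      and i: "i \<in> {1..<d}" and IJ: "I \<subseteq> {..<?m i}" "card I = s i + 1" "J \<subseteq> {..<?n i}" "card J = s i + 1"
      using pm unfolding minor_system_def proj assms(2) by blast
    show ?thesis
      unfolding p by (rule tensor_polynomial_minor[OF pc[OF i] tensor_polynomial_projected[OF Lc[OF i] Rc[OF i]] IJ])
  qed
  then show ?thesis using cone by (simp only: minors L_def[symmetric] R_def[symmetric]) blast
qed

end
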